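(* Let $S=\Bbbk[x_1,\dots,x_n]$ be a polynomial ring over a field $\Bbbk$, and let $I$ and $J$ be two homogeneous ideals of $S$ such that $\mathrm{Gens}(J)\cap\mathrm{Gens}(I)$ consists of at most one element. Then $\operatorname{reg}(IJ)\le \operatorname{reg}(I)+\operatorname{reg}(J)$.
   Context: $S$ has the standard grading ($\deg x_i=1$). For a homogeneous (not necessarily monomial) ideal $I$, $\mathrm{Gens}(I)$ denotes the set of variables $x_i$ that occur in the elements of the (chosen) minimal homogeneous generating set of $I$. Thus the hypothesis says that $I$ and $J$ have minimal homogeneous generating sets such that at most one variable occurs in both. For a finitely generated graded $S$-module $L$, $M_i(L)$ denotes the highest shift appearing in homological degree $i$ of the graded minimal $S$-free resolution of $L$ (i.e. the largest degree of a basis element of the $i$-th free module), and the Castelnuovo-Mumford regularity is $\operatorname{reg}(L)=\max\{M_i(L)-i : i\ge 0\}$, with the convention $\operatorname{reg}(0)=-\infty$. *)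

theory Defs
  imports
    "HOL-Library.Poly_Mapping"
    "HOL-Library.Function_Algebras"
    "HOL-Library.Extended_Real"
begin

section \<open>The standard graded polynomial ring\<close>

text \<open>
  Polynomials over \<^typ>\<open>'k\<close> in the variables \<open>x\<^sub>i\<close>, \<open>i :: 'n\<close>, for a finite index type
  \<^typ>\<open>'n\<close>: finitely supported maps from exponent vectors to coefficients, with the convolution
  product of the library.
\<close>

type_synonym ('n, 'k) mpoly = "('n \<Rightarrow>\<^sub>0 nat) \<Rightarrow>\<^sub>0 'k"

definition Var :: "'n \<Rightarrow> ('n, 'k::field) mpoly" where
  "Var i = Poly_Mapping.single (Poly_Mapping.single i 1) 1"

definition total_deg :: "('n::finite \<Rightarrow>\<^sub>0 nat) \<Rightarrow> nat" where
  "total_deg m = (\<Sum>i\<in>UNIV. Poly_Mapping.lookup m i)"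

text \<open>The graded component \<open>S\<^sub>e\<close>; it contains \<open>0\<close>, and it is \<open>{0}\<close> for \<open>e < 0\<close>.\<close>

definition poly_comp :: "int \<Rightarrow> ('n::finite, 'k::field) mpoly set" where
  "poly_comp e = {p. \<forall>m\<in>Poly_Mapping.keys p. int (total_deg m) = e}"

definition homogeneous :: "('n::finite, 'k::field) mpoly \<Rightarrow> bool" where
  "homogeneous p \<longleftrightarrow> (\<exists>e. p \<in> poly_comp e)"

definition vars :: "('n, 'k::field) mpoly \<Rightarrow> 'n set" where
  "vars p = (\<Union>m\<in>Poly_Mapping.keys p. Poly_Mapping.keys m)"


section \<open>Ideals\<close>

text \<open>
  The polynomial ring is regarded as a module over itself, so that its ideals are the
  library's \<^term>\<open>module.subspace (*)\<close> and the ideal generated by \<open>A\<close> is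
  \<^term>\<open>module.span (*) A\<close>.
\<close>

lemma module_times: "module ((*) :: 'a::comm_ring_1 \<Rightarrow> 'a \<Rightarrow> 'a)"
  by unfold_locales (simp_all add: algebra_simps)

abbreviation is_ideal :: "'a::comm_ring_1 set \<Rightarrow> bool" where
  "is_ideal \<equiv> module.subspace (*)"

abbreviation ideal_gen :: "'a::comm_ring_1 set \<Rightarrow> 'a set" where
  "ideal_gen \<equiv> module.span (*)"

definition ideal_prod :: "'a::comm_ring_1 set \<Rightarrow> 'a set \<Rightarrow> 'a set" where
  "ideal_prod I J = ideal_gen {a * b | a b. a \<in> I \<and> b \<in> J}"

definition homogeneous_ideal :: "('n::finite, 'k::field) mpoly set \<Rightarrow> bool" where
  "homogeneous_ideal I \<longleftrightarrow> is_ideal I \<and> (\<exists>A. (\<forall>p\<in>A. homogeneous p) \<and> I = ideal_gen A)"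

definition minimal_homogeneous_gens ::
  "('n::finite, 'k::field) mpoly set \<Rightarrow> ('n, 'k) mpoly set \<Rightarrow> bool" where
  "minimal_homogeneous_gens A I \<longleftrightarrow>
     (\<forall>p\<in>A. homogeneous p) \<and> ideal_gen A = I \<and> (\<forall>A'. A' \<subset> A \<longrightarrow> ideal_gen A' \<noteq> I)"

text \<open>\<open>Gens\<close> of an ideal depends on the chosen generating set, which is the argument here.\<close>

definition Gens :: "('n, 'k::field) mpoly set \<Rightarrow> 'n set" where
  "Gens A = (\<Union>p\<in>A. vars p)"

definition irrelevant_ideal :: "('n, 'k::field) mpoly set" where
  "irrelevant_ideal = ideal_gen (range Var)"


section \<open>Graded modules and minimal graded free resolutions\<close>

record ('s, 'm) graded_module =
  carr :: "'m set"
  gscale :: "'s \<Rightarrow> 'm \<Rightarrow> 'm"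
  gcomp :: "int \<Rightarrow> 'm set"

definition ideal_module :: "('n::finite, 'k::field) mpoly set \<Rightarrow>
    (('n, 'k) mpoly, ('n, 'k) mpoly) graded_module" where
  "ideal_module I = \<lparr>carr = I, gscale = (*), gcomp = (\<lambda>e. I \<inter> poly_comp e)\<rparr>"

text \<open>
  The free module \<open>\<Oplus>\<^sub>j\<^sub><\<^sub>r S(-d\<^sub>j)\<close>, with basis elements \<open>e\<^sub>j\<close> of degree \<open>d\<^sub>j\<close>: its elements are the
  coordinate functions vanishing from \<open>r\<close> on, and \<open>v\<close> has degree \<open>e\<close> iff each \<open>v\<^sub>j\<close> has degree
  \<open>e - d\<^sub>j\<close>.
\<close>

definition free_module :: "nat \<Rightarrow> (nat \<Rightarrow> int) \<Rightarrow>
    (('n::finite, 'k::field) mpoly, nat \<Rightarrow> ('n, 'k) mpoly) graded_module" where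
  "free_module r d =
     \<lparr>carr = {v. \<forall>j\<ge>r. v j = 0},
      gscale = (\<lambda>p v j. p * v j),
      gcomp = (\<lambda>e. {v. (\<forall>j\<ge>r. v j = 0) \<and> (\<forall>j<r. v j \<in> poly_comp (e - d j))})\<rparr>"

text \<open>Homomorphisms of degree 0. Only their values on \<^term>\<open>carr M\<close> matter.\<close>

definition graded_hom ::
  "('s, 'a::ab_group_add) graded_module \<Rightarrow> ('s, 'b::ab_group_add) graded_module \<Rightarrow> ('a \<Rightarrow> 'b) \<Rightarrow> bool"
where
  "graded_hom M N f \<longleftrightarrow>
     f ` carr M \<subseteq> carr N \<and>
     (\<forall>u\<in>carr M. \<forall>v\<in>carr M. f (u + v) = f u + f v) \<and>
     (\<forall>p. \<forall>v\<in>carr M. f (gscale M p v) = gscale N p (f v)) \<and>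
     (\<forall>e. f ` gcomp M e \<subseteq> gcomp N e)"

text \<open>
  The exact complex \<open>\<dots> \<rightarrow> F\<^sub>2 \<rightarrow> F\<^sub>1 \<rightarrow> F\<^sub>0 \<rightarrow> M \<rightarrow> 0\<close> with \<open>F\<^sub>i = \<Oplus>\<^sub>j\<^sub><\<^sub>r\<^sub>(\<^sub>i\<^sub>) S(-d\<^sub>i\<^sub>j)\<close>,
  augmentation \<open>\<epsilon> : F\<^sub>0 \<rightarrow> M\<close> and differentials \<open>\<delta>\<^sub>i : F\<^sub>i\<^sub>+\<^sub>1 \<rightarrow> F\<^sub>i\<close>.
\<close>

definition graded_free_resolution ::
  "(('n::finite, 'k::field) mpoly, 'b::ab_group_add) graded_module \<Rightarrow>
   (nat \<Rightarrow> nat) \<Rightarrow> (nat \<Rightarrow> nat \<Rightarrow> int) \<Rightarrow>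
   (nat \<Rightarrow> (nat \<Rightarrow> ('n, 'k) mpoly) \<Rightarrow> (nat \<Rightarrow> ('n, 'k) mpoly)) \<Rightarrow>
   ((nat \<Rightarrow> ('n, 'k) mpoly) \<Rightarrow> 'b) \<Rightarrow> bool" where
  "graded_free_resolution M r d \<delta> \<epsilon> \<longleftrightarrow>
     (let F = (\<lambda>i. free_module (r i) (d i)) in
       graded_hom (F 0) M \<epsilon> \<and>
       \<epsilon> ` carr (F 0) = carr M \<and>
       (\<forall>i. graded_hom (F (Suc i)) (F i) (\<delta> i)) \<and>
       \<delta> 0 ` carr (F 1) = {v \<in> carr (F 0). \<epsilon> v = 0} \<and>
       (\<forall>i. \<delta> (Suc i) ` carr (F (Suc (Suc i))) = {v \<in> carr (F (Suc i)). \<delta> i v = 0}))"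

text \<open>
  Minimality: \<open>\<delta>\<^sub>i(F\<^sub>i\<^sub>+\<^sub>1) \<subseteq> \<mm>F\<^sub>i\<close> for \<open>\<mm> = (x\<^sub>1,\<dots>,x\<^sub>n)\<close>; the elements of \<open>\<mm>F\<^sub>i\<close> are those with all
  coordinates in \<open>\<mm>\<close>.
\<close>

definition minimal_graded_free_resolution ::
  "(('n::finite, 'k::field) mpoly, 'b::ab_group_add) graded_module \<Rightarrow>
   (nat \<Rightarrow> nat) \<Rightarrow> (nat \<Rightarrow> nat \<Rightarrow> int) \<Rightarrow>
   (nat \<Rightarrow> (nat \<Rightarrow> ('n, 'k) mpoly) \<Rightarrow> (nat \<Rightarrow> ('n, 'k) mpoly)) \<Rightarrow>
   ((nat \<Rightarrow> ('n, 'k) mpoly) \<Rightarrow> 'b) \<Rightarrow> bool" where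
  "minimal_graded_free_resolution M r d \<delta> \<epsilon> \<longleftrightarrow>
     graded_free_resolution M r d \<delta> \<epsilon> \<and>
     (\<forall>i. \<forall>v\<in>carr (free_module (r (Suc i)) (d (Suc i))). \<forall>j. \<delta> i v j \<in> irrelevant_ideal)"


section \<open>Castelnuovo-Mumford regularity\<close>

text \<open>
  The degrees of the basis elements of the \<open>i\<close>-th module of the minimal graded free resolution.
  That resolution is unique up to isomorphism, so every choice of it gives the same set.
\<close>

definition shifts ::
  "(('n::finite, 'k::field) mpoly, 'b::ab_group_add) graded_module \<Rightarrow> nat \<Rightarrow> int set" where
  "shifts M i = {e. \<exists>r d \<delta> \<epsilon>. minimal_graded_free_resolution M r d \<delta> \<epsilon> \<and> (\<exists>j<r i. e = d i j)}"

text \<open>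
  For a finitely generated graded module the two suprema below are maxima, except that the
  supremum of the empty set is \<open>-\<infinity>\<close>; in particular the zero module has regularity \<open>-\<infinity>\<close>.
\<close>

definition max_shift ::
  "(('n::finite, 'k::field) mpoly, 'b::ab_group_add) graded_module \<Rightarrow> nat \<Rightarrow> ereal" where
  "max_shift M i = (SUP e\<in>shifts M i. ereal (real_of_int e))"

definition reg ::
  "(('n::finite, 'k::field) mpoly, 'b::ab_group_add) graded_module \<Rightarrow> ereal" where
  "reg M = (SUP i. max_shift M i - ereal (real i))"

end

theory Submission
  imports Defs
begin

text \<open>
  Write \<open>\<Bbbk>[V]\<close> for the polynomials in the variables of \<open>V\<close>. Since the generators of \<open>I\<close> and \<open>J\<close>
  share at most one variable, there are a variable \<open>z\<close> and sets \<open>V\<close>, \<open>Y\<close> of variables, covering all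
  variables and meeting exactly in \<open>z\<close>, such that \<open>I\<close> is generated in \<open>\<Bbbk>[V]\<close> and \<open>J\<close> in \<open>\<Bbbk>[Y]\<close>.
  Then \<open>S = \<Bbbk>[V] \<otimes> \<Bbbk>[Y]\<close> over \<open>\<Bbbk>[z]\<close>. Ideals are torsion-free, hence flat, over the principal ideal
  domain \<open>\<Bbbk>[z]\<close>, and therefore \<open>Tor\<^sub>i(I, J) = 0\<close> for \<open>i > 0\<close> and \<open>I \<otimes> J = IJ\<close>. So if \<open>F\<close> is a minimal
  resolution of \<open>I\<close> with matrices over \<open>\<Bbbk>[V]\<close>, the complex \<open>\<dots> \<rightarrow> JF\<^sub>1 \<rightarrow> JF\<^sub>0 \<rightarrow> IJ \<rightarrow> 0\<close> is exact,
  where \<open>JF\<^sub>i\<close> consists of the vectors of \<open>F\<^sub>i\<close> with coordinates in \<open>J\<close>. Now \<open>JF\<^sub>i\<close> is a direct sum of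
  modules \<open>J(-d\<^sub>i\<^sub>j)\<close> with \<open>d\<^sub>i\<^sub>j \<le> reg I + i\<close>, so its regularity is at most \<open>reg I + reg J + i\<close>, and cutting
  the complex into short exact sequences bounds the regularity of \<open>IJ\<close> by \<open>reg I + reg J\<close>.

  The exactness is \<open>prod_family_image\<close>. It rests on an elementary form of flatness,
  \<open>syzygies_over_ideal\<close>: a syzygy with coordinates in \<open>J\<close> of vectors over \<open>\<Bbbk>[V]\<close> is a combination, with
  coefficients in \<open>J\<close>, of syzygies over \<open>\<Bbbk>[V]\<close>. One writes it as \<open>\<Sum> n w\<^sub>n\<close> with as few homogeneous
  \<open>n \<in> J \<inter> \<Bbbk>[Y]\<close> as possible and \<open>w\<^sub>n\<close> over \<open>\<Bbbk>[V]\<close>. If some \<open>w\<^sub>n\<close> were not a syzygy, the \<open>n\<close> would be linearly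
  dependent over \<open>\<Bbbk>[V]\<close>; comparing coefficients yields a relation \<open>\<Sum> c\<^sub>n z\<^bsup>k(n)\<^esup> n = 0\<close> with constants
  \<open>c\<^sub>n\<close>, and after cancelling the least power of \<open>z\<close> it expresses one \<open>n\<close> through the others
  (\<open>monomial_relation_solvable\<close>), contrary to minimality.

  Regularity is controlled by the predicate \<open>reg_le n c H\<close>: the graded module \<open>H\<close> has generators of
  degree at most \<open>c\<close> whose syzygies have generators of degree at most \<open>c + 1\<close>, and so on for \<open>n\<close> steps.
  As the generators may be chosen freely and need not be minimal, the predicate passes along short
  exact sequences (\<open>reg_le_extension\<close>, \<open>reg_le_quotient\<close>) without any use of \<open>Tor\<close>. Nevertheless it bounds
  the shifts of every minimal resolution (\<open>degrees_le_if_reg_le\<close>), because it is inherited by the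
  syzygies of any generators of degree at most \<open>c\<close> (\<open>reg_le_syz\<close>).

  Conversely, upper bounds for \<open>reg I\<close> and \<open>reg J\<close> are informative only once minimal resolutions of
  \<open>I\<close> and \<open>J\<close> are known to exist. They are built step by step in \<open>pvec_resolution_exists\<close>, from
  Hilbert's basis theorem for graded modules and, to stay over \<open>\<Bbbk>[V]\<close>, from \<open>syzygies_over_ideal\<close> for the
  unit ideal.
\<close>

abbreviation lookup where "lookup \<equiv> Poly_Mapping.lookup"
abbreviation keys where "keys \<equiv> Poly_Mapping.keys"
abbreviation single where "single \<equiv> Poly_Mapping.single"

section \<open>Terms, homogeneous components and variables\<close>

definition restrict_terms :: "'a set \<Rightarrow> ('a \<Rightarrow>\<^sub>0 'b::zero) \<Rightarrow> ('a \<Rightarrow>\<^sub>0 'b)" where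
  "restrict_terms T p = Poly_Mapping.mapp (\<lambda>m c. c when m \<in> T) p"

lemma lookup_restrict_terms: "lookup (restrict_terms T p) m = (if m \<in> T then lookup p m else 0)"
  by (auto simp: restrict_terms_def lookup_mapp when_def in_keys_iff)

lemma keys_restrict_terms: "keys (restrict_terms T p) = keys p \<inter> T"
  by (auto simp: in_keys_iff lookup_restrict_terms split: if_splits)

lemma restrict_terms_0 [simp]: "restrict_terms T 0 = 0"
  by (rule poly_mapping_eqI) (simp add: lookup_restrict_terms)

lemma restrict_terms_add:
  "restrict_terms T (p + q) = restrict_terms T p + restrict_terms T (q :: 'a \<Rightarrow>\<^sub>0 'b::monoid_add)"
  by (rule poly_mapping_eqI) (simp add: lookup_restrict_terms lookup_add)

lemma restrict_terms_sum:
  "restrict_terms T (sum f A) = (\<Sum>a\<in>A. restrict_terms T (f a :: 'a \<Rightarrow>\<^sub>0 'b::comm_monoid_add))"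
  by (induction A rule: infinite_finite_induct) (auto simp: restrict_terms_add)

lemma restrict_terms_id: "keys p \<subseteq> T \<Longrightarrow> restrict_terms T p = p"
  by (rule poly_mapping_eqI) (auto simp: lookup_restrict_terms in_keys_iff)

lemma restrict_terms_eq_0: "keys p \<inter> T = {} \<Longrightarrow> restrict_terms T p = 0"
  by (rule poly_mapping_eqI) (auto simp: lookup_restrict_terms in_keys_iff)

text \<open>
  Used when the monomials of \<open>q\<close> agree in the property that defines \<open>E\<close>, such as the total degree, so
  that only the monomial of \<open>p\<close> decides whether a product is kept.
\<close>

lemma restrict_terms_mult:
  fixes p q :: "('a::monoid_add) \<Rightarrow>\<^sub>0 'b::ring_1"
  assumes "\<And>m m'. m \<in> keys p \<Longrightarrow> m' \<in> keys q \<Longrightarrow> m + m' \<in> E \<longleftrightarrow> m \<in> T"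
  shows "restrict_terms E (p * q) = restrict_terms T p * q"
proof -
  have split: "p = restrict_terms T p + restrict_terms (- T) p"
    by (rule poly_mapping_eqI) (simp add: lookup_restrict_terms lookup_add)
  have "keys (restrict_terms T p * q) \<subseteq> E"
    using keys_mult[of "restrict_terms T p" q] assms by (fastforce simp: keys_restrict_terms)
  moreover have "keys (restrict_terms (- T) p * q) \<inter> E = {}"
    using keys_mult[of "restrict_terms (- T) p" q] assms by (fastforce simp: keys_restrict_terms)
  ultimately have "restrict_terms E (restrict_terms T p * q + restrict_terms (- T) p * q)
      = restrict_terms T p * q"
    by (simp add: restrict_terms_add restrict_terms_id restrict_terms_eq_0)
  then show ?thesis using split by (metis distrib_right)
qed

lemma lookup_single_mult:
  fixes p :: "('n \<Rightarrow>\<^sub>0 nat) \<Rightarrow>\<^sub>0 'k::field"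
  shows "lookup (single t c * p) (t + m) = c * lookup p m"
proof -
  have "restrict_terms {t + m} (p * single t c) = restrict_terms {m} p * single t c"
    by (rule restrict_terms_mult) (auto simp: add.commute split: if_splits)
  also have "restrict_terms {m} p = single m (lookup p m)"
    by (rule poly_mapping_eqI) (auto simp: lookup_restrict_terms lookup_single when_def)
  finally have "lookup (restrict_terms {t + m} (p * single t c)) (t + m) = lookup p m * c"
    by (simp add: mult_single add.commute)
  then show ?thesis by (simp add: lookup_restrict_terms mult.commute)
qed

lemma single_mult_cancel:
  fixes p q :: "('n \<Rightarrow>\<^sub>0 nat) \<Rightarrow>\<^sub>0 'k::field"
  assumes "single t 1 * p = single t 1 * q"
  shows "p = q"
proof (rule poly_mapping_eqI)
  fix m
  have "lookup (single t 1 * p) (t + m) = lookup (single t 1 * q) (t + m)" by (simp only: assms)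
  then show "lookup p m = lookup q m" by (simp only: lookup_single_mult mult_1)
qed

lemma sum_singles: "p = (\<Sum>m\<in>keys p. single m (lookup p m))"
  by (rule poly_mapping_eqI)
    (simp add: lookup_sum lookup_single when_def in_keys_iff)

lemma total_deg_add: "total_deg (m + m') = total_deg m + total_deg m'"
  by (simp add: total_deg_def lookup_add sum.distrib)

lemma total_deg_eq_0: "total_deg m = 0 \<longleftrightarrow> m = 0"
  by (auto simp: total_deg_def intro!: poly_mapping_eqI)

lemma total_deg_0 [simp]: "total_deg 0 = 0" by (simp add: total_deg_eq_0)

lemma total_deg_single: "total_deg (single i k) = k"
  by (simp add: total_deg_def lookup_single when_def)

lemma poly_comp_0 [simp]: "0 \<in> poly_comp e" by (simp add: poly_comp_def)

lemma poly_comp_add: "p \<in> poly_comp e \<Longrightarrow> q \<in> poly_comp e \<Longrightarrow> p + q \<in> poly_comp e"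
  using keys_add[of p q] by (auto simp: poly_comp_def)

lemma poly_comp_single: "single m c \<in> poly_comp (int (total_deg m))"
  by (simp add: poly_comp_def)

lemma poly_comp_mult: "p \<in> poly_comp a \<Longrightarrow> q \<in> poly_comp b \<Longrightarrow> p * q \<in> poly_comp (a + b)"
  using keys_mult[of p q] by (fastforce simp: poly_comp_def total_deg_add)

lemma poly_comp_mult': "p \<in> poly_comp a \<Longrightarrow> q \<in> poly_comp b \<Longrightarrow> e = a + b \<Longrightarrow> p * q \<in> poly_comp e"
  by (simp add: poly_comp_mult)

lemma poly_comp_const: "single 0 c \<in> poly_comp 0"
  using poly_comp_single[of 0 c] by simp

lemma poly_comp_1 [simp]: "1 \<in> poly_comp 0"
  using poly_comp_const[of 1] by simp

lemma poly_comp_uminus: "p \<in> poly_comp e \<Longrightarrow> - p \<in> poly_comp e"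
  by (simp add: poly_comp_def in_keys_iff)

lemma poly_comp_diff: "p \<in> poly_comp e \<Longrightarrow> q \<in> poly_comp e \<Longrightarrow> p - q \<in> poly_comp e"
  using poly_comp_add[of p e "- q"] poly_comp_uminus by auto

lemma poly_comp_neg: "p \<in> poly_comp e \<Longrightarrow> e < 0 \<Longrightarrow> p = 0"
  by (rule poly_mapping_eqI) (auto simp: poly_comp_def in_keys_iff)

definition hom_part :: "int \<Rightarrow> ('n::finite, 'k::field) mpoly \<Rightarrow> ('n, 'k) mpoly" where
  "hom_part e = restrict_terms {m. int (total_deg m) = e}"

lemma hom_part_in [simp]: "hom_part e p \<in> poly_comp e"
  by (auto simp: hom_part_def poly_comp_def keys_restrict_terms)

lemma hom_part_id: "p \<in> poly_comp e \<Longrightarrow> hom_part e p = p"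
  by (auto simp: hom_part_def poly_comp_def intro!: restrict_terms_id)

lemma hom_part_0 [simp]: "hom_part e 0 = 0" by (simp add: hom_part_def)

lemma hom_part_add: "hom_part e (p + q) = hom_part e p + hom_part e q"
  by (simp add: hom_part_def restrict_terms_add)

lemma hom_part_sum: "hom_part e (sum f A) = (\<Sum>a\<in>A. hom_part e (f a))"
  by (simp add: hom_part_def restrict_terms_sum)

lemma hom_part_mult:
  assumes "q \<in> poly_comp a"
  shows "hom_part e (p * q) = hom_part (e - a) p * q"
  unfolding hom_part_def using assms
  by (intro restrict_terms_mult) (auto simp: poly_comp_def total_deg_add)

lemma hom_part_sum_degrees:
  assumes "finite E" and "\<And>m. m \<in> keys p \<Longrightarrow> int (total_deg m) \<in> E"
  shows "(\<Sum>e\<in>E. hom_part e p) = p"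
proof (rule poly_mapping_eqI)
  fix m
  have "lookup (\<Sum>e\<in>E. hom_part e p) m = (\<Sum>e\<in>E. if int (total_deg m) = e then lookup p m else 0)"
    by (simp add: lookup_sum hom_part_def lookup_restrict_terms)
  also have "\<dots> = lookup p m"
    using assms by (auto simp: sum.delta' in_keys_iff)
  finally show "lookup (\<Sum>e\<in>E. hom_part e p) m = lookup p m" .
qed

lemma hom_part_0_degree: "hom_part 0 p = single 0 (lookup p 0)"
  by (rule poly_mapping_eqI)
    (auto simp: hom_part_def lookup_restrict_terms lookup_single when_def total_deg_eq_0)

definition polys_in :: "'n set \<Rightarrow> ('n, 'k::field) mpoly set" where
  "polys_in V = {p. vars p \<subseteq> V}"

lemma polys_in_iff: "p \<in> polys_in V \<longleftrightarrow> (\<forall>m\<in>keys p. keys m \<subseteq> V)"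
  by (auto simp: polys_in_def vars_def)

lemma polys_in_UNIV [simp]: "polys_in UNIV = UNIV" by (auto simp: polys_in_def)

lemma polys_in_0 [simp]: "0 \<in> polys_in V" by (simp add: polys_in_iff)

lemma polys_in_1 [simp]: "1 \<in> polys_in V" by (simp add: polys_in_iff)

lemma polys_in_add: "p \<in> polys_in V \<Longrightarrow> q \<in> polys_in V \<Longrightarrow> p + q \<in> polys_in V"
  using keys_add[of p q] by (auto simp: polys_in_iff)

lemma polys_in_uminus: "p \<in> polys_in V \<Longrightarrow> - p \<in> polys_in V"
  by (simp add: polys_in_iff in_keys_iff)

lemma polys_in_mult:
  assumes "p \<in> polys_in V" "q \<in> polys_in V" shows "p * q \<in> polys_in V"
  unfolding polys_in_iff
proof
  fix m assume "m \<in> keys (p * q)"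
  then obtain a b where "m = a + b" "a \<in> keys p" "b \<in> keys q"
    using keys_mult[of p q] by blast
  then show "keys m \<subseteq> V"
    using assms keys_add[of a b] by (fastforce simp: polys_in_iff)
qed

lemma polys_in_sum: "(\<And>a. a \<in> A \<Longrightarrow> f a \<in> polys_in V) \<Longrightarrow> sum f A \<in> polys_in V"
  by (induction A rule: infinite_finite_induct) (auto intro: polys_in_add)

lemma polys_in_single: "keys m \<subseteq> V \<Longrightarrow> single m c \<in> polys_in V"
  by (simp add: polys_in_iff)

lemma polys_in_hom_part: "p \<in> polys_in V \<Longrightarrow> hom_part e p \<in> polys_in V"
  by (simp add: polys_in_iff hom_part_def keys_restrict_terms)


section \<open>Ideals\<close>

interpretation idl: module "(*) :: ('n, 'k::field) mpoly \<Rightarrow> ('n, 'k) mpoly \<Rightarrow> ('n, 'k) mpoly"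
  by (rule module_times)

text \<open>
  Multiplication by a homogeneous generator shifts degrees, so taking a component of a combination of
  the generators amounts to taking components of the coefficients.
\<close>

lemma hom_part_in_ideal:
  assumes "\<forall>b\<in>B. homogeneous b" and "p \<in> ideal_gen B"
  shows "hom_part e p \<in> ideal_gen B"
  using assms(2)
proof (induction rule: idl.span_induct_alt)
  case base then show ?case by (simp add: idl.span_zero)
next
  case (step c x y)
  from step(1) assms obtain a where a: "x \<in> poly_comp a" by (auto simp: homogeneous_def)
  show ?case
    using step by (simp add: hom_part_add hom_part_mult[OF a] idl.span_add idl.span_scale idl.span_base)
qed

text \<open>
  A product with a variable has no constant term; conversely every nonconstant monomial is divisible
  by some variable.
\<close>

lemma in_irrelevant_ideal_iff: "p \<in> irrelevant_ideal \<longleftrightarrow> lookup p 0 = 0"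
proof
  assume "p \<in> irrelevant_ideal"
  then have "p \<in> ideal_gen (range Var)" by (simp add: irrelevant_ideal_def)
  then show "lookup p 0 = 0"
  proof (induction rule: idl.span_induct_alt)
    case base then show ?case by simp
  next
    case (step c x y)
    then obtain i where x: "x = Var i" by auto
    have "0 \<notin> keys (c * Var i :: ('a, 'b) mpoly)"
    proof
      assume "0 \<in> keys (c * Var i :: ('a, 'b) mpoly)"
      then obtain a b :: "'a \<Rightarrow>\<^sub>0 nat" where ab: "0 = a + b" "b \<in> keys (Var i :: ('a, 'b) mpoly)"
        using keys_mult[of c "Var i"] by blast
      have "lookup (a + b) i \<ge> 1" using ab(2) by (simp add: Var_def lookup_add split: if_splits)
      then show False by (simp flip: ab(1))
    qed
    then show ?case using step x by (simp add: lookup_add in_keys_iff)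
  qed
next
  assume "lookup p 0 = 0"
  have "single m (lookup p m) \<in> irrelevant_ideal" if "m \<in> keys p" for m
  proof -
    from that \<open>lookup p 0 = 0\<close> have "m \<noteq> 0" by (auto simp: in_keys_iff)
    then obtain i where i: "lookup m i > 0" by (metis gr0I lookup_zero poly_mapping_eqI)
    have "m = (m - single i 1) + single i 1"
      by (rule poly_mapping_eqI) (use i in \<open>auto simp: lookup_add lookup_minus lookup_single when_def\<close>)
    then have "single m (lookup p m) = single (m - single i 1) (lookup p m) * Var i"
      by (metis Var_def mult.right_neutral mult_single)
    then show ?thesis by (simp add: irrelevant_ideal_def idl.span_base idl.span_scale)
  qed
  then have "(\<Sum>m\<in>keys p. single m (lookup p m)) \<in> irrelevant_ideal"
    unfolding irrelevant_ideal_def by (intro idl.span_sum) auto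
  then show "p \<in> irrelevant_ideal" using sum_singles[of p] by simp
qed


section \<open>Vectors of polynomials\<close>

type_synonym ('n, 'k) pvec = "nat \<Rightarrow> ('n, 'k) mpoly"

definition vscale :: "('n, 'k::field) mpoly \<Rightarrow> ('n, 'k) pvec \<Rightarrow> ('n, 'k) pvec" where
  "vscale p v = (\<lambda>j. p * v j)"

lemma vscale_apply [simp]: "vscale p v j = p * v j" by (simp add: vscale_def)

interpretation vec: module "vscale :: ('n, 'k::field) mpoly \<Rightarrow> ('n, 'k) pvec \<Rightarrow> ('n, 'k) pvec"
proof
  fix a b :: "('n, 'k::field) mpoly" and x y :: "('n, 'k) pvec"
  show "vscale a (x + y) = vscale a x + vscale a y"
    by (rule ext) (simp add: distrib_left)
  show "vscale (a + b) x = vscale a x + vscale b x"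
    by (rule ext) (simp add: distrib_right)
  show "vscale a (vscale b x) = vscale (a * b) x"
    by (rule ext) (simp only: vscale_apply mult.assoc)
  show "vscale 1 x = x"
    by (rule ext) (simp only: vscale_apply mult_1)
qed

lemma sum_fun_at [simp]: "(\<Sum>a\<in>A. f a) j = (\<Sum>a\<in>A. f a j)" for f :: "'a \<Rightarrow> 'b \<Rightarrow> 'c::comm_monoid_add"
  by (induction A rule: infinite_finite_induct) auto


definition unit_vec :: "nat \<Rightarrow> ('n, 'k::field) pvec" where
  "unit_vec i = (\<lambda>j. if j = i then 1 else 0)"

text \<open>The map \<open>S\<^sup>r \<rightarrow> S\<^sup>\<nat>\<close> sending the basis vectors to \<open>g\<^sub>0, \<dots>, g\<^sub>r\<^sub>-\<^sub>1\<close>.\<close>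

definition lincomb :: "nat \<Rightarrow> (nat \<Rightarrow> ('n, 'k::field) pvec) \<Rightarrow> ('n, 'k) pvec \<Rightarrow> ('n, 'k) pvec" where
  "lincomb r g v = (\<Sum>j<r. vscale (v j) (g j))"

lemma lincomb_at: "lincomb r g v i = (\<Sum>j<r. v j * g j i)"
  by (simp add: lincomb_def)

definition pvec_linear :: "(('n, 'k::field) pvec \<Rightarrow> ('n, 'k) pvec) \<Rightarrow> bool" where
  "pvec_linear f \<longleftrightarrow> (\<forall>u v. f (u + v) = f u + f v) \<and> (\<forall>p v. f (vscale p v) = vscale p (f v))"

lemma
  assumes "pvec_linear f"
  shows pvec_linear_add: "f (u + v) = f u + f v"
    and pvec_linear_scale: "f (vscale p v) = vscale p (f v)"
    and pvec_linear_0: "f 0 = 0"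
    and pvec_linear_diff: "f (u - v) = f u - f v"
    and pvec_linear_sum: "f (sum h A) = (\<Sum>a\<in>A. f (h a))"
    and pvec_linear_lincomb: "f (lincomb r g v) = lincomb r (\<lambda>j. f (g j)) v"
proof -
  interpret module_hom vscale vscale f
    by unfold_locales (use assms in \<open>auto simp: pvec_linear_def\<close>)
  show "f (u + v) = f u + f v" "f (vscale p v) = vscale p (f v)" "f 0 = 0" "f (u - v) = f u - f v"
    "f (sum h A) = (\<Sum>a\<in>A. f (h a))" by (rule add scale zero diff sum)+
  show "f (lincomb r g v) = lincomb r (\<lambda>j. f (g j)) v"
    by (simp add: lincomb_def sum scale)
qed

lemma pvec_linear_lincomb_map [simp]: "pvec_linear (lincomb r g)"
  unfolding pvec_linear_def
proof (intro conjI allI ext)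
  fix u v :: "('a, 'b) pvec" and p :: "('a, 'b) mpoly" and i
  show "lincomb r g (u + v) i = (lincomb r g u + lincomb r g v) i"
    by (simp add: lincomb_at sum.distrib distrib_right)
  show "lincomb r g (vscale p v) i = vscale p (lincomb r g v) i"
    by (simp only: lincomb_at vscale_apply sum_distrib_left mult.assoc)
qed

lemma lincomb_unit_vec: "j < r \<Longrightarrow> lincomb r g (unit_vec j) = g j"
  by (rule ext) (simp add: lincomb_at unit_vec_def if_distrib[of "\<lambda>x. x * _"] cong: if_cong)

text \<open>The graded pieces of \<open>\<Oplus>\<^sub>j\<^sub><\<^sub>r S(-d\<^sub>j)\<close>.\<close>

definition free_comp :: "nat \<Rightarrow> (nat \<Rightarrow> int) \<Rightarrow> int \<Rightarrow> ('n::finite, 'k::field) pvec set" where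
  "free_comp r d e = {v. (\<forall>j\<ge>r. v j = 0) \<and> (\<forall>j<r. v j \<in> poly_comp (e - d j))}"

abbreviation free_carr :: "nat \<Rightarrow> ('n, 'k::field) pvec set" where
  "free_carr r \<equiv> {v. \<forall>j\<ge>r. v j = 0}"

lemma free_comp_carr: "v \<in> free_comp r d e \<Longrightarrow> j \<ge> r \<Longrightarrow> v j = 0"
  by (simp add: free_comp_def)

lemma free_comp_coord: "v \<in> free_comp r d e \<Longrightarrow> v j \<in> poly_comp (e - d j)"
  by (cases "j < r") (auto simp: free_comp_def)

lemma unit_vec_free_comp: "j < r \<Longrightarrow> unit_vec j \<in> free_comp r d (d j)"
  by (auto simp: free_comp_def unit_vec_def)

lemma free_carr_eq_lincomb: "v \<in> free_carr r \<Longrightarrow> lincomb r unit_vec v = v"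
  by (rule ext) (simp add: lincomb_at unit_vec_def if_distrib[of "\<lambda>x. _ * x"] not_less cong: if_cong)

definition vec_hom_part :: "(nat \<Rightarrow> int) \<Rightarrow> int \<Rightarrow> ('n::finite, 'k::field) pvec \<Rightarrow> ('n, 'k) pvec" where
  "vec_hom_part d e v = (\<lambda>j. hom_part (e - d j) (v j))"

lemma vec_hom_part_in: "v \<in> free_carr r \<Longrightarrow> vec_hom_part d e v \<in> free_comp r d e"
  by (simp add: vec_hom_part_def free_comp_def)

lemma vec_hom_part_id: "v \<in> free_comp r d e \<Longrightarrow> vec_hom_part d e v = v"
  by (auto simp: vec_hom_part_def fun_eq_iff free_comp_coord hom_part_id)

lemma vec_hom_part_lincomb:
  assumes "\<And>j. j < r \<Longrightarrow> g j \<in> free_comp s D (d j)"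
  shows "vec_hom_part D e (lincomb r g v) = lincomb r g (vec_hom_part d e v)"
proof
  fix i
  have "hom_part (e - D i) (v j * g j i) = hom_part (e - d j) (v j) * g j i" if "j < r" for j
    using hom_part_mult[OF free_comp_coord[OF assms[OF that]], of "e - D i" "v j" i] by simp
  then show "vec_hom_part D e (lincomb r g v) i = lincomb r g (vec_hom_part d e v) i"
    by (simp add: vec_hom_part_def lincomb_at hom_part_sum)
qed

lemma vec_hom_part_sum_degrees:
  fixes v :: "('n::finite, 'k::field) pvec"
  assumes "v \<in> free_carr r"
  obtains E where "finite E" "(\<Sum>e\<in>E. vec_hom_part d e v) = v"
proof
  let ?E = "\<Union>j<r. (\<lambda>m. int (total_deg m) + d j) ` keys (v j)"
  show "finite ?E" by simp
  show "(\<Sum>e\<in>?E. vec_hom_part d e v) = v"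
  proof
    fix j
    show "(\<Sum>e\<in>?E. vec_hom_part d e v) j = v j"
    proof (cases "j < r")
      case True
      have "(\<Sum>e\<in>?E. hom_part (e - d j) (v j)) = (\<Sum>e\<in>(\<lambda>e. e - d j) ` ?E. hom_part e (v j))"
        by (subst sum.reindex) (auto simp: inj_on_def)
      also have "\<dots> = v j"
      proof (rule hom_part_sum_degrees)
        fix m assume "m \<in> keys (v j)"
        then show "int (total_deg m) \<in> (\<lambda>e. e - d j) ` ?E"
          using True by (intro image_eqI[where x = "int (total_deg m) + d j"]) auto
      qed simp
      finally show ?thesis by (simp add: vec_hom_part_def)
    qed (use assms in \<open>simp add: vec_hom_part_def\<close>)
  qed
qed

(* As simplification rules these would also act on the eta-expansions of vectors; the passage from
   vectors to coordinates is made explicitly instead. *)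
lemmas pvec_at = plus_fun_apply zero_fun_apply minus_apply uminus_apply sum_fun_at vscale_apply

declare pvec_at [simp del]


section \<open>Bounding the degrees of a resolution step by step\<close>

text \<open>
  A graded module is represented by its homogeneous components, all contained in the vectors of
  polynomials. No inhomogeneous element is ever mentioned, so the degrees that a component has in the
  surrounding free module need not be recorded.
\<close>

definition graded_family :: "(int \<Rightarrow> ('n::finite, 'k::field) pvec set) \<Rightarrow> bool" where
  "graded_family H \<longleftrightarrow>
     (\<forall>e. 0 \<in> H e) \<and> (\<forall>e. \<forall>u\<in>H e. \<forall>v\<in>H e. u + v \<in> H e) \<and>
     (\<forall>a e. \<forall>p\<in>poly_comp a. \<forall>v\<in>H e. vscale p v \<in> H (a + e))"

lemma
  assumes "graded_family H"
  shows graded_family_0: "0 \<in> H e"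
    and graded_family_add: "u \<in> H e \<Longrightarrow> v \<in> H e \<Longrightarrow> u + v \<in> H e"
    and graded_family_scale: "p \<in> poly_comp a \<Longrightarrow> v \<in> H e' \<Longrightarrow> e = a + e' \<Longrightarrow> vscale p v \<in> H e"
  using assms by (auto simp: graded_family_def)

lemma graded_family_sum:
  assumes "graded_family H" "\<And>a. a \<in> A \<Longrightarrow> f a \<in> H e"
  shows "sum f A \<in> H e"
  using assms(2)
  by (induction A rule: infinite_finite_induct)
    (auto intro: graded_family_0 graded_family_add assms(1))

lemma graded_family_uminus:
  assumes "graded_family H" "v \<in> H e"
  shows "- v \<in> H e"
  using graded_family_scale[OF assms(1) poly_comp_uminus[OF poly_comp_1] assms(2)] by simp

lemma graded_family_diff:
  assumes "graded_family H" "u \<in> H e" "v \<in> H e"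
  shows "u - v \<in> H e"
  using graded_family_add[OF assms(1,2) graded_family_uminus[OF assms(1,3)]] by simp

lemma graded_family_lincomb:
  assumes "graded_family H" "\<And>j. j < r \<Longrightarrow> g j \<in> H (d j)" "v \<in> free_comp r d e"
  shows "lincomb r g v \<in> H e"
  unfolding lincomb_def
  by (rule graded_family_sum[OF assms(1)])
    (auto intro!: graded_family_scale[OF assms(1) free_comp_coord[OF assms(3)] assms(2)])

lemma graded_family_free: "graded_family (free_comp r d)"
  by (auto simp: graded_family_def free_comp_def pvec_at intro!: poly_comp_add
      intro: poly_comp_mult')

lemma graded_family_kernel:
  assumes "graded_family H" "pvec_linear f"
  shows "graded_family (\<lambda>e. {v \<in> H e. f v = 0})"
  using assms(1) unfolding graded_family_def
  by (auto simp: pvec_linear_0[OF assms(2)] pvec_linear_add[OF assms(2)] pvec_linear_scale[OF assms(2)])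

definition syz_comp :: "nat \<Rightarrow> (nat \<Rightarrow> ('n::finite, 'k::field) pvec) \<Rightarrow> (nat \<Rightarrow> int) \<Rightarrow> int
    \<Rightarrow> ('n, 'k) pvec set" where
  "syz_comp r g d e = {v \<in> free_comp r d e. lincomb r g v = 0}"

lemma graded_family_syz: "graded_family (syz_comp r g d)"
  unfolding syz_comp_def by (rule graded_family_kernel[OF graded_family_free]) simp

text \<open>
  The generators need not be minimal, but every homogeneous element is required to be a combination
  of them with homogeneous coefficients of the right degrees.
\<close>

definition generated_by :: "(int \<Rightarrow> ('n::finite, 'k::field) pvec set) \<Rightarrow> nat \<Rightarrow>
    (nat \<Rightarrow> ('n, 'k) pvec) \<Rightarrow> (nat \<Rightarrow> int) \<Rightarrow> bool" where
  "generated_by H r g d \<longleftrightarrow>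
     (\<forall>j<r. g j \<in> H (d j)) \<and> (\<forall>e. \<forall>m\<in>H e. \<exists>v\<in>free_comp r d e. lincomb r g v = m)"

text \<open>
  For a finitely generated graded module with components \<open>H\<close> this means that
  \<open>Tor\<^sub>i(H, \<Bbbk>)\<close> vanishes in degrees above \<open>c + i\<close> for all \<open>i < n\<close>. The bound on the number of steps makes
  induction possible along resolutions of infinite length.
\<close>

primrec reg_le :: "nat \<Rightarrow> int \<Rightarrow> (int \<Rightarrow> ('n::finite, 'k::field) pvec set) \<Rightarrow> bool" where
  "reg_le 0 c H \<longleftrightarrow> True"
| "reg_le (Suc n) c H \<longleftrightarrow>
     (\<exists>r g d. generated_by H r g d \<and> (\<forall>j<r. d j \<le> c) \<and> reg_le n (c + 1) (syz_comp r g d))"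

lemma reg_le_zero: "reg_le n c (\<lambda>e. {0})"
proof (induction n arbitrary: c)
  case (Suc n)
  have "syz_comp 0 (\<lambda>_. 0) (\<lambda>_. 0) = (\<lambda>e. {0 :: ('a::finite, 'b::field) pvec})"
    by (auto simp: syz_comp_def free_comp_def fun_eq_iff lincomb_def pvec_at)
  then have "generated_by (\<lambda>e. {0 :: ('a, 'b) pvec}) 0 (\<lambda>_. 0) (\<lambda>_. 0) \<and>
      reg_le n (c + 1) (syz_comp 0 (\<lambda>_. 0 :: ('a, 'b) pvec) (\<lambda>_. 0))"
    using Suc[of "c + 1"]
    by (auto simp: generated_by_def free_comp_def lincomb_def intro!: exI[of _ "\<lambda>_. 0"])
  then show ?case unfolding reg_le.simps by blast
qed simp

lemma reg_le_mono: "reg_le n c H \<Longrightarrow> c \<le> c' \<Longrightarrow> reg_le n c' H"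
proof (induction n arbitrary: c c' H)
  case (Suc n)
  then obtain r g d where "generated_by H r g d" "\<forall>j<r. d j \<le> c" "reg_le n (c + 1) (syz_comp r g d)"
    by auto
  moreover have "reg_le n (c' + 1) (syz_comp r g d)"
    using Suc calculation(3) by force
  ultimately show ?case using \<open>c \<le> c'\<close> by fastforce
qed simp

lemma reg_le_shift: "reg_le n c H \<Longrightarrow> reg_le n (c + a) (\<lambda>e. H (e - a))"
proof (induction n arbitrary: c H)
  case (Suc n)
  then obtain r g d where 1: "generated_by H r g d" and 2: "\<forall>j<r. d j \<le> c"
    and 3: "reg_le n (c + 1) (syz_comp r g d)"
    by auto
  let ?d = "\<lambda>j. d j + a"
  have fc: "free_comp r ?d e = free_comp r d (e - a)" for e
    by (simp add: free_comp_def algebra_simps)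
  have "syz_comp r g ?d = (\<lambda>e. syz_comp r g d (e - a))"
    by (simp add: syz_comp_def fc fun_eq_iff)
  then have "reg_le n (c + a + 1) (syz_comp r g ?d)"
    using Suc.IH[OF 3] by (simp add: algebra_simps)
  moreover have "generated_by (\<lambda>e. H (e - a)) r g ?d"
    using 1 by (auto simp: generated_by_def fc)
  moreover have "\<forall>j<r. ?d j \<le> c + a" using 2 by auto
  ultimately show ?case unfolding reg_le.simps by blast
qed simp

text \<open>
  Generators without relations: the module is free, and its syzygies vanish.
\<close>

lemma reg_le_basis:
  assumes "generated_by H r g d" "\<forall>j<r. d j \<le> c"
    and "\<And>v. v \<in> free_carr r \<Longrightarrow> lincomb r g v = 0 \<Longrightarrow> v = 0"
  shows "reg_le n c H"
proof (cases n)
  case (Suc m)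
  have "syz_comp r g d = (\<lambda>e. {0})"
  proof (rule ext)
    fix e
    show "syz_comp r g d e = {0}"
      using assms(3) graded_family_0[OF graded_family_syz, of r g d e]
      by (auto simp: syz_comp_def free_comp_def)
  qed
  then have "reg_le m (c + 1) (syz_comp r g d)" by (simp add: reg_le_zero)
  then show ?thesis using assms(1,2) unfolding Suc reg_le.simps by blast
qed simp

lemma generated_by_unit_vec: "generated_by (free_comp r d) r unit_vec d"
  unfolding generated_by_def
proof (intro conjI allI impI ballI)
  fix e m assume "m \<in> free_comp r d e"
  then show "\<exists>v\<in>free_comp r d e. lincomb r unit_vec v = m"
    by (intro bexI[of _ m]) (auto intro!: free_carr_eq_lincomb simp: free_comp_def)
qed (rule unit_vec_free_comp)

lemma reg_le_free:
  assumes "\<forall>j<r. d j \<le> c"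
  shows "reg_le n c (free_comp r d)"
proof (rule reg_le_basis[OF generated_by_unit_vec assms])
  fix v :: "('a, 'b) pvec" assume "v \<in> free_carr r" "lincomb r unit_vec v = 0"
  then show "v = 0" using free_carr_eq_lincomb[of v r] by simp
qed

definition cat :: "nat \<Rightarrow> (nat \<Rightarrow> 'a) \<Rightarrow> (nat \<Rightarrow> 'a) \<Rightarrow> nat \<Rightarrow> 'a" where
  "cat r f g j = (if j < r then f j else g (j - r))"

definition drop_coords :: "nat \<Rightarrow> ('n, 'k::field) pvec \<Rightarrow> ('n, 'k) pvec" where
  "drop_coords r v = (\<lambda>j. v (r + j))"

lemma cat_simps [simp]: "j < r \<Longrightarrow> cat r f g j = f j" "cat r f g (r + j) = g j"
  by (auto simp: cat_def)

lemma drop_coords_cat [simp]: "drop_coords r (cat r f g) = g"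
  by (simp add: drop_coords_def)

lemma pvec_linear_drop_coords [simp]: "pvec_linear (drop_coords r)"
  by (auto simp: pvec_linear_def drop_coords_def fun_eq_iff pvec_at)

lemma lincomb_cat: "lincomb (r + s) (cat r f g) v = lincomb r f v + lincomb s g (drop_coords r v)"
proof (induction s)
  case 0
  then show ?case by (simp add: lincomb_def)
next
  case (Suc s)
  then show ?case by (simp add: lincomb_def drop_coords_def add.assoc)
qed

lemma lincomb_cong_coords: "(\<And>j. j < r \<Longrightarrow> u j = v j) \<Longrightarrow> lincomb r g u = lincomb r g v"
  by (simp add: lincomb_def)

lemma free_comp_cat:
  "v \<in> free_comp (r + s) (cat r d d') e \<longleftrightarrow>
     (\<forall>j<r. v j \<in> poly_comp (e - d j)) \<and> drop_coords r v \<in> free_comp s d' e" (is "?L \<longleftrightarrow> ?R")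
proof
  assume ?L
  note L = this
  have A: "v j = 0" if "j \<ge> r + s" for j using L that by (simp add: free_comp_def)
  have B: "v j \<in> poly_comp (e - cat r d d' j)" if "j < r + s" for j
    using L that by (simp add: free_comp_def)
  have "v j \<in> poly_comp (e - d j)" if "j < r" for j using B[of j] that by simp
  moreover have "v (r + j) \<in> poly_comp (e - d' j)" if "j < s" for j using B[of "r + j"] that by simp
  ultimately show ?R using A by (simp add: free_comp_def drop_coords_def)
next
  assume R: ?R
  show ?L unfolding free_comp_def
  proof (intro CollectI conjI allI impI)
    fix j assume "r + s \<le> j"
    then have "v (r + (j - r)) = 0"
      using free_comp_carr[of "drop_coords r v" s d' e "j - r"] R by (simp add: drop_coords_def)
    then show "v j = 0" using \<open>r + s \<le> j\<close> by simp
  next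
    fix j assume j: "j < r + s"
    show "v j \<in> poly_comp (e - cat r d d' j)"
    proof (cases "j < r")
      case False
      have "drop_coords r v (j - r) \<in> poly_comp (e - d' (j - r))"
        using R free_comp_coord by blast
      then show ?thesis using False by (simp add: drop_coords_def cat_def)
    qed (use R in simp)
  qed
qed

lemma cat_in_free_comp:
  assumes "u \<in> free_comp r d e" "w \<in> free_comp s d' e"
  shows "cat r u w \<in> free_comp (r + s) (cat r d d') e"
  unfolding free_comp_cat using assms by (auto simp: free_comp_coord)

text \<open>
  A syzygy of the concatenated generators that involves only the first \<open>r\<close> of them is a syzygy of these.
\<close>

lemma syz_cat_drop_kernel:
  "{v \<in> syz_comp (r + s) (cat r a b) (cat r d d') e. drop_coords r v = 0} = syz_comp r a d e"
  (is "?L = ?R")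
proof (intro equalityI subsetI)
  fix v assume v: "v \<in> ?L"
  then have "lincomb (r + s) (cat r a b) v = 0" "drop_coords r v = 0" "v \<in> free_comp (r + s) (cat r d d') e"
    by (auto simp: syz_comp_def)
  moreover have "v j = 0" if "j \<ge> r" for j
    using fun_cong[OF \<open>drop_coords r v = 0\<close>, of "j - r"] that by (simp add: drop_coords_def pvec_at)
  ultimately show "v \<in> ?R"
    by (simp add: syz_comp_def lincomb_cat pvec_linear_0 free_comp_cat) (simp add: free_comp_def)
next
  fix v assume v: "v \<in> ?R"
  then have "drop_coords r v = 0"
    by (auto simp: syz_comp_def free_comp_def drop_coords_def fun_eq_iff pvec_at)
  then show "v \<in> ?L"
    using v by (auto simp: syz_comp_def lincomb_cat pvec_linear_0 free_comp_cat free_comp_coord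
        graded_family_0[OF graded_family_free])
qed

text \<open>
  Horseshoe lemma for \<open>0 \<rightarrow> ker f \<rightarrow> B \<rightarrow> f(B) \<rightarrow> 0\<close>: generators of the kernel together with lifts of
  generators of the image generate \<open>B\<close>, and the syzygies of these generators are in turn an extension
  of the syzygies of the image by those of the kernel.
\<close>

lemma reg_le_extension:
  assumes "graded_family B" "pvec_linear f"
    and "reg_le n c (\<lambda>e. {b \<in> B e. f b = 0})" and "reg_le n c (\<lambda>e. f ` B e)"
  shows "reg_le n c B"
  using assms
proof (induction n arbitrary: c B f)
  case (Suc n)
  note B = Suc.prems(1) and f = Suc.prems(2)
  obtain r a d where a: "generated_by (\<lambda>e. {b \<in> B e. f b = 0}) r a d" "\<forall>j<r. d j \<le> c"
    and ra: "reg_le n (c + 1) (syz_comp r a d)"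
    using Suc.prems(3) by auto
  obtain s q d' where q: "generated_by (\<lambda>e. f ` B e) s q d'" "\<forall>j<s. d' j \<le> c"
    and rq: "reg_le n (c + 1) (syz_comp s q d')"
    using Suc.prems(4) by auto
  have "q j \<in> f ` B (d' j)" if "j < s" for j using q(1) that by (simp add: generated_by_def)
  then have "\<forall>j. \<exists>b. j < s \<longrightarrow> b \<in> B (d' j) \<and> f b = q j" by (metis imageE)
  then obtain b where b: "\<And>j. j < s \<Longrightarrow> b j \<in> B (d' j)" "\<And>j. j < s \<Longrightarrow> f (b j) = q j"
    by metis
  have fb: "f (lincomb s b w) = lincomb s q w" for w
    unfolding pvec_linear_lincomb[OF f] using b(2) by (simp add: lincomb_def)
  have aB: "a j \<in> B (d j)" "f (a j) = 0" if "j < r" for j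
    using a(1) that by (auto simp: generated_by_def)
  have fa: "f (lincomb r a w) = 0" for w
    unfolding pvec_linear_lincomb[OF f] using aB(2) by (simp add: lincomb_def vec.sum_constant_scale)
  let ?g = "cat r a b" and ?d = "cat r d d'"
  have gen: "generated_by B (r + s) ?g ?d"
    unfolding generated_by_def
  proof (intro conjI allI impI ballI)
    fix j assume "j < r + s"
    then show "?g j \<in> B (?d j)" using aB b by (auto simp: cat_def)
  next
    fix e x assume x: "x \<in> B e"
    then obtain w where w: "w \<in> free_comp s d' e" "lincomb s q w = f x"
      using q(1) by (fastforce simp: generated_by_def)
    have "x - lincomb s b w \<in> {b \<in> B e. f b = 0}"
      using x w by (auto simp: pvec_linear_diff[OF f] fb intro!: graded_family_diff[OF B]
          graded_family_lincomb[OF B b(1)])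
    then obtain u where u: "u \<in> free_comp r d e" "lincomb r a u = x - lincomb s b w"
      using a(1) by (fastforce simp: generated_by_def)
    show "\<exists>v\<in>free_comp (r + s) ?d e. lincomb (r + s) ?g v = x"
    proof
      have "lincomb r a (cat r u w) = lincomb r a u" by (rule lincomb_cong_coords) simp
      then show "lincomb (r + s) ?g (cat r u w) = x"
        using u by (simp add: lincomb_cat)
    qed (rule cat_in_free_comp[OF u(1) w(1)])
  qed
  have "drop_coords r ` syz_comp (r + s) ?g ?d e = syz_comp s q d' e" for e
  proof (intro equalityI subsetI)
    fix w assume "w \<in> drop_coords r ` syz_comp (r + s) ?g ?d e"
    then obtain v where v: "v \<in> syz_comp (r + s) ?g ?d e" "w = drop_coords r v" by auto
    then have "f (lincomb r a v + lincomb s b w) = f 0"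
      by (simp add: syz_comp_def lincomb_cat)
    then have "lincomb s q w = 0"
      by (simp add: pvec_linear_add[OF f] pvec_linear_0[OF f] fa fb)
    then show "w \<in> syz_comp s q d' e"
      using v by (auto simp: syz_comp_def free_comp_cat)
  next
    fix w assume w: "w \<in> syz_comp s q d' e"
    then have "- lincomb s b w \<in> {b \<in> B e. f b = 0}"
      using graded_family_uminus[OF B graded_family_lincomb[OF B b(1)]]
        pvec_linear_diff[OF f, of 0 "lincomb s b w"]
      by (auto simp: syz_comp_def fb pvec_linear_0[OF f])
    then obtain u where u: "u \<in> free_comp r d e" "lincomb r a u = - lincomb s b w"
      using a(1) by (fastforce simp: generated_by_def)
    have "lincomb r a (cat r u w) = lincomb r a u" by (rule lincomb_cong_coords) simp
    then have "cat r u w \<in> syz_comp (r + s) ?g ?d e"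
      using cat_in_free_comp[OF u(1)] w u by (auto simp: syz_comp_def lincomb_cat)
    then show "w \<in> drop_coords r ` syz_comp (r + s) ?g ?d e"
      by (intro image_eqI[of _ _ "cat r u w"]) auto
  qed
  then have "reg_le n (c + 1) (syz_comp (r + s) ?g ?d)"
    using Suc.IH[OF graded_family_syz[of "r + s" ?g ?d] pvec_linear_drop_coords[of r], of "c + 1"] ra rq
    by (simp add: syz_cat_drop_kernel)
  moreover have "\<forall>j<r + s. ?d j \<le> c" using a(2) q(2) by (auto simp: cat_def)
  ultimately show ?case using gen unfolding reg_le.simps by blast
qed simp

text \<open>
  The images of generators \<open>g\<close> of \<open>B\<close> generate \<open>f(B)\<close>. Evaluating a syzygy of the images at \<open>g\<close> gives an
  element of the kernel of \<open>f\<close>, so the syzygies of the images are an extension of \<open>ker f\<close> by the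
  syzygies of \<open>g\<close>.
\<close>

lemma reg_le_quotient:
  assumes B: "graded_family B" and f: "pvec_linear f"
    and "reg_le (Suc n) c B" and ker: "reg_le n (c + 1) (\<lambda>e. {b \<in> B e. f b = 0})"
  shows "reg_le (Suc n) c (\<lambda>e. f ` B e)"
proof -
  obtain r g d where g: "generated_by B r g d" "\<forall>j<r. d j \<le> c" "reg_le n (c + 1) (syz_comp r g d)"
    using assms(3) by auto
  let ?g = "\<lambda>j. f (g j)"
  have fg: "lincomb r ?g v = f (lincomb r g v)" for v
    by (simp add: pvec_linear_lincomb[OF f])
  have gB: "g j \<in> B (d j)" if "j < r" for j using g(1) that by (simp add: generated_by_def)
  have "generated_by (\<lambda>e. f ` B e) r ?g d"
    unfolding generated_by_def
  proof (intro conjI allI impI ballI)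
    fix e m assume "m \<in> f ` B e"
    then obtain b where "m = f b" "b \<in> B e" by auto
    then show "\<exists>v\<in>free_comp r d e. lincomb r ?g v = m"
      using g(1) unfolding fg generated_by_def by metis
  qed (use gB in auto)
  moreover have "reg_le n (c + 1) (syz_comp r ?g d)"
  proof (rule reg_le_extension[OF graded_family_syz pvec_linear_lincomb_map])
    have "{v \<in> syz_comp r ?g d e. lincomb r g v = 0} = syz_comp r g d e" for e
      by (auto simp: syz_comp_def fg pvec_linear_0[OF f])
    then show "reg_le n (c + 1) (\<lambda>e. {v \<in> syz_comp r ?g d e. lincomb r g v = 0})"
      using g(3) by simp
    have "lincomb r g ` syz_comp r ?g d e = {b \<in> B e. f b = 0}" for e
    proof (intro equalityI subsetI)
      fix b assume b: "b \<in> {b \<in> B e. f b = 0}"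
      then obtain v where "v \<in> free_comp r d e" "lincomb r g v = b"
        using g(1) unfolding generated_by_def by blast
      then show "b \<in> lincomb r g ` syz_comp r ?g d e"
        using b by (auto simp: syz_comp_def fg)
    qed (auto simp: syz_comp_def fg intro: graded_family_lincomb[OF B gB])
    then show "reg_le n (c + 1) (\<lambda>e. lincomb r g ` syz_comp r ?g d e)"
      using ker by simp
  qed
  ultimately show ?thesis using g(2) unfolding reg_le.simps by blast
qed

text \<open>
  This is Schanuel's lemma. For generators \<open>g\<close> as in the definition of \<^const>\<open>reg_le\<close>, let \<open>K\<close> be
  the syzygies of \<open>g\<close> and \<open>h\<close> together. Projecting \<open>K\<close> to the coordinates of \<open>h\<close> exhibits it as an
  extension of a free module by the syzygies of \<open>g\<close>, which bounds its degrees. Substituting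
  expressions of the \<open>g\<close> through the \<open>h\<close> maps \<open>K\<close> onto the syzygies of \<open>h\<close>, with a free kernel, and
  the bound passes to this quotient.
\<close>

lemma reg_le_syz:
  fixes H :: "int \<Rightarrow> ('n::finite, 'k::field) pvec set"
  assumes H: "graded_family H" and h: "generated_by H s h d'" "\<forall>j<s. d' j \<le> c"
    and "reg_le (Suc n) c H"
  shows "reg_le n (c + 1) (syz_comp s h d')"
proof (cases n)
  case (Suc m)
  obtain r g d where g: "generated_by H r g d" "\<forall>j<r. d j \<le> c" "reg_le n (c + 1) (syz_comp r g d)"
    using assms(4) by auto
  have gH: "g j \<in> H (d j)" if "j < r" for j using g(1) that by (simp add: generated_by_def)
  have hH: "h j \<in> H (d' j)" if "j < s" for j using h(1) that by (simp add: generated_by_def)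
  let ?g = "cat r g h" and ?d = "cat r d d'"
  let ?K = "syz_comp (r + s) ?g ?d"
  have drop: "drop_coords r ` ?K e = free_comp s d' e" for e
  proof (intro equalityI subsetI)
    fix w :: "('n, 'k) pvec" assume w: "w \<in> free_comp s d' e"
    have "- lincomb s h w \<in> H e"
      by (intro graded_family_uminus[OF H] graded_family_lincomb[OF H hH w])
    then obtain u where u: "u \<in> free_comp r d e" "lincomb r g u = - lincomb s h w"
      using g(1) unfolding generated_by_def by blast
    have "lincomb r g (cat r u w) = lincomb r g u" by (rule lincomb_cong_coords) simp
    then have "cat r u w \<in> ?K e"
      using cat_in_free_comp[OF u(1) w] u by (auto simp: syz_comp_def lincomb_cat)
    then show "w \<in> drop_coords r ` ?K e"
      by (intro image_eqI[of _ _ "cat r u w"]) auto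
  qed (auto simp: syz_comp_def free_comp_cat)
  have K: "reg_le n (c + 1) ?K"
  proof (rule reg_le_extension[OF graded_family_syz pvec_linear_drop_coords])
    show "reg_le n (c + 1) (\<lambda>e. {v \<in> ?K e. drop_coords r v = 0})"
      using g(3) by (simp add: syz_cat_drop_kernel)
    have "reg_le n (c + 1) (free_comp s d')" by (rule reg_le_free) (use h(2) in force)
    then show "reg_le n (c + 1) (\<lambda>e. drop_coords r ` ?K e)"
      by (simp add: drop)
  qed
  have "\<exists>t\<in>free_comp s d' (d j). lincomb s h t = g j" if "j < r" for j
    using h(1) gH[OF that] unfolding generated_by_def by blast
  then have "\<forall>j. \<exists>t. j < r \<longrightarrow> t \<in> free_comp s d' (d j) \<and> lincomb s h t = g j"
    by blast
  then obtain t where t: "\<And>j. j < r \<Longrightarrow> t j \<in> free_comp s d' (d j)"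
    "\<And>j. j < r \<Longrightarrow> lincomb s h (t j) = g j"
    by metis
  define f where "f = (\<lambda>v. drop_coords r v + lincomb r t v)"
  have f: "pvec_linear f"
    unfolding pvec_linear_def f_def
    by (auto simp: pvec_linear_add[OF pvec_linear_drop_coords] pvec_linear_add[OF pvec_linear_lincomb_map]
        pvec_linear_scale[OF pvec_linear_drop_coords] pvec_linear_scale[OF pvec_linear_lincomb_map]
        vec.scale_right_distrib)
  have hf: "lincomb s h (f v) = lincomb (r + s) ?g v" for v
  proof -
    have "lincomb s h (lincomb r t v) = lincomb r g v"
      unfolding pvec_linear_lincomb[OF pvec_linear_lincomb_map] using t(2) by (simp add: lincomb_def)
    then show ?thesis
      by (simp add: f_def pvec_linear_add[OF pvec_linear_lincomb_map] lincomb_cat)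
  qed
  have "f ` ?K e = syz_comp s h d' e" for e
  proof (intro equalityI subsetI)
    fix w assume w: "w \<in> f ` ?K e"
    then obtain v where v: "v \<in> ?K e" "w = f v" by auto
    have "lincomb s h w = 0" using v hf by (simp add: syz_comp_def)
    moreover have "lincomb r t (\<lambda>j. if j < r then v j else 0) = lincomb r t v"
      by (rule lincomb_cong_coords) simp
    moreover have "(\<lambda>j. if j < r then v j else 0) \<in> free_comp r d e"
      using v by (simp add: syz_comp_def free_comp_cat) (simp add: free_comp_def)
    then have "lincomb r t (\<lambda>j. if j < r then v j else 0) \<in> free_comp s d' e"
      by (intro graded_family_lincomb[OF graded_family_free t(1)])
    ultimately show "w \<in> syz_comp s h d' e"
      using v by (auto simp: syz_comp_def f_def free_comp_cat intro: graded_family_add[OF graded_family_free])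
  next
    fix w assume w: "w \<in> syz_comp s h d' e"
    have 0: "lincomb r g' (cat r 0 w) = 0" for g' :: "nat \<Rightarrow> ('n, 'k) pvec"
      using lincomb_cong_coords[of r "cat r 0 w" 0 g'] by (simp add: pvec_linear_0)
    then have "cat r 0 w \<in> ?K e"
      using cat_in_free_comp[OF graded_family_0[OF graded_family_free]] w
      by (auto simp: syz_comp_def lincomb_cat)
    moreover have "w = f (cat r 0 w)" by (simp add: f_def 0)
    ultimately show "w \<in> f ` ?K e" by blast
  qed
  moreover have "reg_le (Suc m) (c + 1) (\<lambda>e. f ` ?K e)"
  proof (rule reg_le_quotient[OF graded_family_syz f])
    show "reg_le (Suc m) (c + 1) ?K" using K Suc by simp
    \<comment> \<open>The kernel of \<open>f\<close> is the graph of \<open>u \<mapsto> - lincomb r t u\<close>, free on the vectors \<open>?a j\<close>.\<close>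
    let ?a = "\<lambda>j. cat r (unit_vec j) (- t j)"
    have cut: "lincomb r ?a u = cat r u (- lincomb r t u)" (is "?lhs = ?rhs") if "u \<in> free_carr r" for u
    proof
      fix i
      show "?lhs i = ?rhs i"
      proof (cases "i < r")
        case True
        then show ?thesis by (simp add: lincomb_at unit_vec_def if_distrib[of "\<lambda>x. _ * x"] cong: if_cong)
      next
        case False
        then obtain k where "i = r + k" by (metis le_Suc_ex not_less)
        then show ?thesis by (simp add: lincomb_at sum_negf pvec_at)
      qed
    qed
    show "reg_le m (c + 1 + 1) (\<lambda>e. {b \<in> ?K e. f b = 0})"
    proof (rule reg_le_basis[where r = r and g = ?a and d = d])
      show "generated_by (\<lambda>e. {b \<in> ?K e. f b = 0}) r ?a d"
        unfolding generated_by_def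
      proof (intro conjI allI impI ballI)
        fix j assume j: "j < r"
        have "lincomb r g' (?a j) = g' j" for g' :: "nat \<Rightarrow> ('n, 'k) pvec"
          using lincomb_cong_coords[of r "?a j" "unit_vec j" g'] lincomb_unit_vec[OF j, of g'] by simp
        then have 0: "f (?a j) = 0" by (simp add: f_def)
        then have "lincomb (r + s) ?g (?a j) = 0"
          using hf[of "?a j"] by (simp add: pvec_linear_0)
        then show "?a j \<in> {b \<in> ?K (d j). f b = 0}"
          using 0 cat_in_free_comp[OF unit_vec_free_comp[OF j, of d] graded_family_uminus[OF graded_family_free t(1)[OF j]]]
          by (simp add: syz_comp_def)
      next
        fix e v assume v: "v \<in> {b \<in> ?K e. f b = 0}"
        define u where "u = (\<lambda>j. if j < r then v j else 0)"
        have u: "u \<in> free_comp r d e"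
          using v by (simp add: u_def syz_comp_def free_comp_cat) (simp add: free_comp_def)
        have "lincomb r t u = lincomb r t v"
          by (rule lincomb_cong_coords) (simp add: u_def)
        then have "drop_coords r v = - lincomb r t u"
          using v by (simp add: f_def eq_neg_iff_add_eq_0)
        moreover have "cat r u (drop_coords r v) = v"
          by (auto simp: cat_def u_def drop_coords_def)
        ultimately have "cat r u (- lincomb r t u) = v" by simp
        then show "\<exists>v'\<in>free_comp r d e. lincomb r ?a v' = v"
          using cut u by (intro bexI[of _ u]) (auto simp: free_comp_def)
      qed
      show "\<forall>j<r. d j \<le> c + 1 + 1" using g(2) by force
      fix u assume u: "u \<in> free_carr r" and "lincomb r ?a u = 0"
      then have 0: "cat r u (- lincomb r t u) = 0" using cut by simp
      have "u j = 0" if "j < r" for j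
      proof -
        have "u j = cat r u (- lincomb r t u) j" using that by simp
        also have "\<dots> = 0" by (simp only: 0 zero_fun_apply)
        finally show ?thesis .
      qed
      moreover have "u j = 0" if "\<not> j < r" for j using u that by simp
      ultimately show "u = 0" by (intro ext) (metis zero_fun_apply)
    qed
  qed
  ultimately show ?thesis using Suc by simp
qed simp

text \<open>
  Rewrite \<open>h j\<close> through generators of degree at most \<open>c\<close> and these again through \<open>h\<close>. If the degree of
  \<open>h j\<close> exceeded \<open>c\<close>, the generator \<open>h j\<close> would not occur in the result for reasons of degree, and the
  difference would be a syzygy of \<open>h\<close> whose coordinate at \<open>j\<close> is \<open>1\<close>.
\<close>

lemma minimal_degree_le:
  fixes H :: "int \<Rightarrow> ('n::finite, 'k::field) pvec set"
  assumes H: "graded_family H" and h: "generated_by H s h d'"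
    and min: "\<And>v e j. v \<in> syz_comp s h d' e \<Longrightarrow> lookup (v j) 0 = 0"
    and g: "reg_le (Suc n) c H" and j: "j < s"
  shows "d' j \<le> c"
proof (rule ccontr)
  assume "\<not> d' j \<le> c"
  obtain r g d where g: "generated_by H r g d" "\<forall>j<r. d j \<le> c"
    using g by auto
  have gH: "g i \<in> H (d i)" if "i < r" for i using g(1) that by (simp add: generated_by_def)
  have "h j \<in> H (d' j)" using h j by (simp add: generated_by_def)
  then obtain v where v: "v \<in> free_comp r d (d' j)" "lincomb r g v = h j"
    using g(1) unfolding generated_by_def by blast
  have "\<exists>t\<in>free_comp s d' (d i). lincomb s h t = g i" if "i < r" for i
    using h(1) gH[OF that] unfolding generated_by_def by blast
  then have "\<forall>i. \<exists>t. i < r \<longrightarrow> t \<in> free_comp s d' (d i) \<and> lincomb s h t = g i"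
    by blast
  then obtain t where t: "\<And>i. i < r \<Longrightarrow> t i \<in> free_comp s d' (d i)"
    "\<And>i. i < r \<Longrightarrow> lincomb s h (t i) = g i"
    by metis
  let ?w = "unit_vec j - lincomb r t v :: ('n, 'k) pvec"
  have "?w \<in> free_comp s d' (d' j)"
    by (intro graded_family_diff[OF graded_family_free] unit_vec_free_comp j
        graded_family_lincomb[OF graded_family_free t(1) v(1)])
  moreover have "lincomb s h (lincomb r t v) = lincomb r g v"
    unfolding pvec_linear_lincomb[OF pvec_linear_lincomb_map] using t(2) by (simp add: lincomb_def)
  then have "lincomb s h ?w = 0"
    by (simp add: pvec_linear_diff[OF pvec_linear_lincomb_map] lincomb_unit_vec[OF j] v(2))
  ultimately have "lookup (?w j) 0 = 0" using min by (simp add: syz_comp_def)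
  \<comment> \<open>All coordinates \<open>t i j\<close> have negative degree.\<close>
  moreover have "t i j = 0" if "i < r" for i
    using free_comp_coord[OF t(1)[OF that], of j] g(2) that \<open>\<not> d' j \<le> c\<close>
    by (intro poly_comp_neg) fastforce+
  then have "lincomb r t v j = 0" by (simp add: lincomb_at)
  ultimately show False by (simp add: unit_vec_def pvec_at)
qed


section \<open>Noetherianity\<close>

lemma incseq_subseq_nat:
  fixes s :: "nat \<Rightarrow> nat"
  obtains \<psi> where "strict_mono \<psi>" "incseq (s \<circ> \<psi>)"
proof -
  obtain \<psi> where \<psi>: "strict_mono \<psi>" "monoseq (\<lambda>n. s (\<psi> n))"
    using seq_monosub[of s] by blast
  show thesis
  proof (cases "incseq (s \<circ> \<psi>)")
    case True
    then show ?thesis using that \<psi>(1) by blast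
  next
    case False
    then have dec: "decseq (s \<circ> \<psi>)" using \<psi>(2) by (simp add: monoseq_iff comp_def)
    obtain N where N: "\<And>n. (s \<circ> \<psi>) N \<le> (s \<circ> \<psi>) n"
      using ex_has_least_nat[of "\<lambda>_. True" 0 "s \<circ> \<psi>"] by auto
    have "(s \<circ> \<psi>) (N + n) = (s \<circ> \<psi>) N" for n
      using N[of "N + n"] decseqD[OF dec, of N "N + n"] by simp
    then have "incseq (s \<circ> (\<lambda>n. \<psi> (N + n)))" by (simp add: incseq_def)
    moreover have "strict_mono (\<lambda>n. \<psi> (N + n))" using \<psi>(1) by (simp add: strict_mono_def)
    ultimately show ?thesis using that by blast
  qed
qed

lemma incseq_coordinates_subseq:
  fixes f :: "nat \<Rightarrow> 'a \<Rightarrow> nat"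
  assumes "finite A"
  shows "\<exists>\<phi>. strict_mono \<phi> \<and> (\<forall>k\<in>A. incseq (\<lambda>i. f (\<phi> i) k))"
  using assms
proof (induction A)
  case empty
  show ?case by (intro exI[of _ id]) (simp add: strict_mono_def)
next
  case (insert a A)
  then obtain \<phi> where \<phi>: "strict_mono \<phi>" "\<forall>k\<in>A. incseq (\<lambda>i. f (\<phi> i) k)" by blast
  obtain \<psi> where \<psi>: "strict_mono \<psi>" "incseq ((\<lambda>i. f (\<phi> i) a) \<circ> \<psi>)"
    by (rule incseq_subseq_nat)
  have "incseq (\<lambda>i. f ((\<phi> \<circ> \<psi>) i) k)" if "k \<in> insert a A" for k
  proof (cases "k = a")
    case False
    then show ?thesis
      using that \<phi>(2) monoD[OF strict_mono_mono[OF \<psi>(1)]] by (auto simp: incseq_def)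
  qed (use \<psi>(2) in \<open>simp add: comp_def\<close>)
  then show ?case using strict_mono_o[OF \<phi>(1) \<psi>(1)] by blast
qed

text \<open>
  Dickson's lemma. The monomials of \<open>M\<close> that are minimal for divisibility form an antichain, and an
  infinite antichain is impossible, since every sequence of exponent vectors has a subsequence along
  which all exponents increase.
\<close>

lemma finite_monomial_basis:
  fixes M :: "('n::finite \<Rightarrow>\<^sub>0 nat) set"
  obtains F where "finite F" "F \<subseteq> M" "\<And>m. m \<in> M \<Longrightarrow> \<exists>m0\<in>F. \<exists>t. m = t + m0"
proof -
  define le where "le = (\<lambda>m m' :: 'n \<Rightarrow>\<^sub>0 nat. \<forall>i. lookup m i \<le> lookup m' i)"
  define F where "F = {m \<in> M. \<forall>m'\<in>M. le m' m \<longrightarrow> m' = m}"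
  have split: "\<exists>t. m = t + m0" if "le m0 m" for m m0
  proof
    show "m = (m - m0) + m0"
      by (rule poly_mapping_eqI) (use that in \<open>simp add: le_def lookup_add lookup_minus\<close>)
  qed
  have "\<exists>m0\<in>F. le m0 m" if "m \<in> M" for m
    using that
  proof (induction "total_deg m" arbitrary: m rule: less_induct)
    case less
    show ?case
    proof (cases "m \<in> F")
      case True
      then show ?thesis by (intro bexI[of _ m]) (simp add: le_def)
    next
      case False
      then obtain m' where m': "m' \<in> M" "le m' m" "m' \<noteq> m" using less.prems by (auto simp: F_def)
      obtain t where t: "m = t + m'" using split[OF m'(2)] by blast
      then have "t \<noteq> 0" using m'(3) by auto
      then have "total_deg m' < total_deg m"
        using t total_deg_eq_0[of t] by (simp add: total_deg_add)
      then obtain m0 where "m0 \<in> F" "le m0 m'" using less.hyps m'(1) by blast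
      moreover have "le m0 m" using \<open>le m0 m'\<close> m'(2) unfolding le_def by (meson order_trans)
      ultimately show ?thesis by blast
    qed
  qed
  moreover have "finite F"
  proof (rule ccontr)
    assume "infinite F"
    then obtain f :: "nat \<Rightarrow> 'n \<Rightarrow>\<^sub>0 nat" where f: "inj f" "range f \<subseteq> F"
      using infinite_countable_subset by blast
    obtain \<phi> where \<phi>: "strict_mono \<phi>" "\<forall>k\<in>UNIV. incseq (\<lambda>i. lookup (f (\<phi> i)) k)"
      using incseq_coordinates_subseq[of UNIV "\<lambda>i. lookup (f i)"] by auto
    have "le (f (\<phi> 0)) (f (\<phi> 1))" using \<phi>(2) by (simp add: le_def incseq_def)
    moreover have "f (\<phi> 0) \<in> F" "f (\<phi> 1) \<in> F" using f(2) by auto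
    ultimately have "f (\<phi> 0) = f (\<phi> 1)" by (simp add: F_def)
    then have "\<phi> 0 = \<phi> 1" using f(1) by (simp add: inj_eq)
    then show False using strict_monoD[OF \<phi>(1), of 0 1] by simp
  qed
  ultimately show thesis using that[of F] split unfolding F_def by blast
qed

lemma finite_monomials_of_degree: "finite {m :: 'n::finite \<Rightarrow>\<^sub>0 nat. int (total_deg m) = e}"
proof (rule finite_imageD)
  have "lookup m i \<le> total_deg m" for m :: "'n \<Rightarrow>\<^sub>0 nat" and i
    by (simp add: total_deg_def member_le_sum)
  then have "lookup ` {m :: 'n \<Rightarrow>\<^sub>0 nat. int (total_deg m) = e} \<subseteq>
      {f. \<forall>i. (i \<in> UNIV \<longrightarrow> f i \<in> {..nat e}) \<and> (i \<notin> UNIV \<longrightarrow> f i = 0)}"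
    by auto
  then show "finite (lookup ` {m :: 'n \<Rightarrow>\<^sub>0 nat. int (total_deg m) = e})"
    by (rule finite_subset) (rule finite_set_of_finite_funs, auto)
  show "inj_on lookup {m :: 'n \<Rightarrow>\<^sub>0 nat. int (total_deg m) = e}"
    by (auto simp: inj_on_def intro: poly_mapping_eqI)
qed

text \<open>
  Enumerating the variables embeds the exponent vectors additively into those with index type
  \<^typ>\<open>nat\<close>, which carry the lexicographic order. Injective and additive maps to them thus encode
  monomial orders.
\<close>

lemma monomial_order:
  obtains \<phi> :: "('n::finite \<Rightarrow>\<^sub>0 nat) \<Rightarrow> (nat \<Rightarrow>\<^sub>0 nat)"
  where "inj \<phi>" "\<And>m m'. \<phi> (m + m') = \<phi> m + \<phi> m'"
proof -
  obtain \<nu> :: "'n \<Rightarrow> nat" where \<nu>: "inj \<nu>"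
    using finite_imp_inj_to_nat_seg[of "UNIV :: 'n set"] by auto
  define \<phi> where "\<phi> = (\<lambda>m :: 'n \<Rightarrow>\<^sub>0 nat. \<Sum>i\<in>UNIV. single (\<nu> i) (lookup m i))"
  have "lookup (\<phi> m) (\<nu> i) = lookup m i" for m i
    using \<nu> by (simp add: \<phi>_def lookup_sum lookup_single when_def inj_eq)
  then have "inj \<phi>" by (metis injI poly_mapping_eqI)
  moreover have "\<phi> (m + m') = \<phi> m + \<phi> m'" for m m'
    by (simp add: \<phi>_def lookup_add single_add sum.distrib)
  ultimately show thesis using that by blast
qed

text \<open>
  Hilbert's basis theorem, by Gordan's argument: choose elements whose leading monomials generate all
  leading monomials of homogeneous elements, and subtract multiples of them to lower the leading
  monomial. For homogeneous elements this terminates, as there are only finitely many monomials of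
  each degree.
\<close>

lemma ideal_finitely_generated:
  fixes K :: "('n::finite, 'k::field) mpoly set"
  assumes K: "is_ideal K" and hom: "\<And>p e. p \<in> K \<Longrightarrow> hom_part e p \<in> K"
  obtains F where "finite F" "F \<subseteq> K" "K \<subseteq> ideal_gen F"
proof -
  obtain \<phi> :: "('n \<Rightarrow>\<^sub>0 nat) \<Rightarrow> (nat \<Rightarrow>\<^sub>0 nat)"
    where \<phi>: "inj \<phi>" "\<And>m m'. \<phi> (m + m') = \<phi> m + \<phi> m'"
    using monomial_order by blast
  define lead where "lead = (\<lambda>p m. m \<in> keys (p :: ('n, 'k) mpoly) \<and> (\<forall>m'\<in>keys p. \<phi> m' \<le> \<phi> m))"
  have lead_ex: "\<exists>m. lead p m" if "p \<noteq> 0" for p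
  proof -
    have "keys p \<noteq> {}" using that by (metis all_not_in_conv in_keys_iff lookup_zero poly_mapping_eqI)
    then have "Max (\<phi> ` keys p) \<in> \<phi> ` keys p" by (intro Max_in) auto
    then obtain m where "m \<in> keys p" "\<phi> m = Max (\<phi> ` keys p)" by (metis imageE)
    then show ?thesis by (auto simp: lead_def)
  qed
  define M where "M = {m. \<exists>p\<in>K. homogeneous p \<and> lead p m}"
  obtain F0 where F0: "finite F0" "F0 \<subseteq> M" "\<And>m. m \<in> M \<Longrightarrow> \<exists>m0\<in>F0. \<exists>t. m = t + m0"
    using finite_monomial_basis by blast
  have "\<forall>m\<in>F0. \<exists>p. p \<in> K \<and> homogeneous p \<and> lead p m" using F0(2) by (auto simp: M_def)
  then obtain G where G: "\<And>m. m \<in> F0 \<Longrightarrow> G m \<in> K \<and> homogeneous (G m) \<and> lead (G m) m" by metis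
  let ?F = "G ` F0"
  have red: "p \<in> ideal_gen ?F" if "p \<in> K" "p \<in> poly_comp e" for p e
  proof (rule ccontr)
    assume "p \<notin> ideal_gen ?F"
    define bad where "bad = (\<lambda>q m. q \<in> K \<and> q \<in> poly_comp e \<and> q \<notin> ideal_gen ?F \<and> lead q m)"
    define W where "W = {m. \<exists>q. bad q m}"
    have "p \<noteq> 0" using \<open>p \<notin> ideal_gen ?F\<close> idl.span_zero by metis
    then obtain m0 where "lead p m0" using lead_ex by blast
    then have "bad p m0" using that \<open>p \<notin> ideal_gen ?F\<close> by (simp add: bad_def)
    then have "W \<noteq> {}" by (auto simp: W_def)
    moreover have "W \<subseteq> {m. int (total_deg m) = e}"
      by (auto simp: W_def bad_def lead_def poly_comp_def)
    then have "finite W" by (rule finite_subset[OF _ finite_monomials_of_degree])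
    ultimately have "Min (\<phi> ` W) \<in> \<phi> ` W" by (intro Min_in) auto
    then obtain m where m: "m \<in> W" "\<phi> m = Min (\<phi> ` W)" by (metis imageE)
    then obtain q where q: "bad q m" by (auto simp: W_def)
    then have "m \<in> M" by (auto simp: bad_def M_def homogeneous_def)
    then obtain m0 t where m0: "m0 \<in> F0" "m = t + m0" using F0(3) by blast
    define g where "g = G m0"
    have g: "g \<in> K" "homogeneous g" "lead g m0" using G[OF m0(1)] by (auto simp: g_def)
    define c where "c = lookup q m / lookup g m0"
    define q' where "q' = q - single t c * g"
    have mq: "m \<in> keys q" and m0g: "m0 \<in> keys g" using q g by (auto simp: bad_def lead_def)
    obtain a where a: "g \<in> poly_comp a" using g(2) by (auto simp: homogeneous_def)
    have "int (total_deg m) = e" "int (total_deg m0) = a"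
      using mq m0g a q by (auto simp: bad_def poly_comp_def)
    then have "single t c * g \<in> poly_comp e"
      using poly_comp_mult[OF poly_comp_single[of t c] a] m0(2) by (simp add: total_deg_add)
    then have 1: "q' \<in> poly_comp e" using q by (auto simp: q'_def bad_def intro: poly_comp_diff)
    have 2: "q' \<in> K"
      using q g(1) by (auto simp: q'_def bad_def intro: idl.subspace_diff[OF K] idl.subspace_scale[OF K])
    have 3: "q' \<notin> ideal_gen ?F"
    proof
      assume "q' \<in> ideal_gen ?F"
      moreover have "single t c * g \<in> ideal_gen ?F"
        using m0(1) by (auto simp: g_def intro: idl.span_scale idl.span_base)
      ultimately have "q' + single t c * g \<in> ideal_gen ?F" by (rule idl.span_add)
      then show False using q by (simp add: q'_def bad_def)
    qed
    then have "q' \<noteq> 0" using idl.span_zero by metis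
    then obtain m' where m': "lead q' m'" using lead_ex by blast
    have "m' \<in> keys q'" using m' by (simp add: lead_def)
    have "lookup q' m = 0"
      using m0g by (simp add: q'_def lookup_minus m0(2) lookup_single_mult c_def in_keys_iff)
    then have "m' \<noteq> m" using \<open>m' \<in> keys q'\<close> by (auto simp: in_keys_iff)
    moreover have "\<phi> m' \<le> \<phi> m"
    proof (cases "m' \<in> keys q")
      case True
      then show ?thesis using q by (auto simp: bad_def lead_def)
    next
      case False
      then have "m' \<in> keys (single t c * g)"
        using \<open>m' \<in> keys q'\<close> by (auto simp: q'_def lookup_minus in_keys_iff)
      then obtain b where "m' = t + b" "b \<in> keys g"
        using keys_mult[of "single t c" g] by (auto split: if_splits)
      then show ?thesis using g(3) m0(2) \<phi>(2) by (auto simp: lead_def intro: add_left_mono)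
    qed
    ultimately have "\<phi> m' < \<phi> m" using \<phi>(1) by (metis injD order_le_less)
    moreover have "m' \<in> W" using 1 2 3 m' by (auto simp: W_def bad_def)
    then have "Min (\<phi> ` W) \<le> \<phi> m'" using \<open>finite W\<close> by simp
    ultimately show False using m(2) by simp
  qed
  have "p \<in> ideal_gen ?F" if "p \<in> K" for p
  proof -
    have "(\<Sum>e\<in>(\<lambda>m. int (total_deg m)) ` keys p. hom_part e p) = p"
      by (rule hom_part_sum_degrees) auto
    moreover have "(\<Sum>e\<in>(\<lambda>m. int (total_deg m)) ` keys p. hom_part e p) \<in> ideal_gen ?F"
      by (intro idl.span_sum red[OF hom[OF that] hom_part_in])
    ultimately show ?thesis by simp
  qed
  then show thesis using that[of ?F] F0(1) G by blast
qed

text \<open>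
  Induction on the rank: the last coordinates form an ideal, and the vectors whose last coordinate
  vanishes form a module of smaller rank.
\<close>

lemma submodule_finitely_generated:
  fixes K :: "('n::finite, 'k::field) pvec set"
  assumes "vec.subspace K" and "\<And>v e. v \<in> K \<Longrightarrow> vec_hom_part D e v \<in> K" and "K \<subseteq> free_carr s"
  shows "\<exists>F. finite F \<and> F \<subseteq> K \<and> K \<subseteq> vec.span F"
  using assms
proof (induction s arbitrary: K)
  case 0
  then have "K \<subseteq> {0}" by (auto simp: fun_eq_iff pvec_at)
  then show ?case by (intro exI[of _ "{}"]) simp
next
  case (Suc s)
  note K = Suc.prems(1) and hom = Suc.prems(2)
  let ?\<aa> = "(\<lambda>v. v s) ` K"
  have "is_ideal ?\<aa>"
  proof (rule idl.subspaceI)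
    show "0 \<in> ?\<aa>" using vec.subspace_0[OF K] by (intro image_eqI[of _ _ 0]) (auto simp: pvec_at)
    show "p + q \<in> ?\<aa>" if pq: "p \<in> ?\<aa>" "q \<in> ?\<aa>" for p q
    proof -
      obtain u v where "u \<in> K" "v \<in> K" "p = u s" "q = v s" using pq by auto
      then show ?thesis using vec.subspace_add[OF K] by (intro image_eqI[of _ _ "u + v"]) (auto simp: pvec_at)
    qed
    show "c * p \<in> ?\<aa>" if p: "p \<in> ?\<aa>" for c p
    proof -
      obtain u where "u \<in> K" "p = u s" using p by auto
      then show ?thesis using vec.subspace_scale[OF K] by (intro image_eqI[of _ _ "vscale c u"]) (auto simp: pvec_at)
    qed
  qed
  moreover have "hom_part e p \<in> ?\<aa>" if p: "p \<in> ?\<aa>" for p e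
  proof -
    obtain u where "u \<in> K" "p = u s" using p by auto
    then show ?thesis
      using hom[of u "e + D s"]
      by (intro image_eqI[of _ _ "vec_hom_part D (e + D s) u"]) (auto simp: vec_hom_part_def)
  qed
  ultimately obtain F1 where F1: "finite F1" "F1 \<subseteq> ?\<aa>" "?\<aa> \<subseteq> ideal_gen F1"
    by (rule ideal_finitely_generated)
  have "\<forall>p\<in>F1. \<exists>v\<in>K. v s = p" using F1(2) by auto
  then obtain L where L: "\<And>p. p \<in> F1 \<Longrightarrow> L p \<in> K \<and> L p s = p" by metis
  let ?K' = "{v \<in> K. v s = 0}"
  have "\<exists>F. finite F \<and> F \<subseteq> ?K' \<and> ?K' \<subseteq> vec.span F"
  proof (rule Suc.IH)
    show "vec.subspace ?K'"
      by (rule vec.subspaceI)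
        (auto simp: pvec_at intro: vec.subspace_0[OF K] vec.subspace_add[OF K] vec.subspace_scale[OF K])
    show "vec_hom_part D e v \<in> ?K'" if "v \<in> ?K'" for v e
      using that hom by (simp add: vec_hom_part_def)
    show "?K' \<subseteq> free_carr s"
    proof clarify
      fix v j assume "v \<in> K" "v s = 0" "s \<le> j"
      then show "v j = 0" using Suc.prems(3) by (cases "j = s") auto
    qed
  qed
  then obtain F2 where F2: "finite F2" "F2 \<subseteq> ?K'" "?K' \<subseteq> vec.span F2" by blast
  let ?F = "L ` F1 \<union> F2"
  have "v \<in> vec.span ?F" if v: "v \<in> K" for v
  proof -
    have "v s \<in> ideal_gen F1" using v F1(3) by auto
    then obtain u where u: "v s = (\<Sum>p\<in>F1. u p * p)" using idl.span_finite[OF F1(1)] by auto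
    let ?w = "\<Sum>p\<in>F1. vscale (u p) (L p)"
    have w: "?w \<in> K" using L by (intro vec.subspace_sum[OF K] vec.subspace_scale[OF K]) auto
    have "?w s = v s" using L by (simp add: pvec_at u)
    then have "v - ?w \<in> ?K'" using vec.subspace_diff[OF K v w] by (simp add: pvec_at)
    then have "v - ?w \<in> vec.span ?F" using F2(3) vec.span_mono[of F2 ?F] by auto
    moreover have "?w \<in> vec.span ?F"
      by (intro vec.span_sum vec.span_scale vec.span_base) auto
    ultimately have "(v - ?w) + ?w \<in> vec.span ?F" by (rule vec.span_add)
    then show ?thesis by simp
  qed
  then show ?case using F1(1) F2 L by (intro exI[of _ ?F]) auto
qed

section \<open>Minimal generators\<close>

lemma vec_hom_part_in_span:
  assumes "\<And>x. x \<in> G \<Longrightarrow> \<exists>a. x \<in> free_comp s D a" and "v \<in> vec.span G"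
  shows "vec_hom_part D e v \<in> vec.span G"
  using assms(2)
proof (induction rule: vec.span_induct_alt)
  case base
  have "vec_hom_part D e 0 = 0" by (simp add: vec_hom_part_def fun_eq_iff pvec_at)
  then show ?case using vec.span_zero by metis
next
  case (step c x y)
  from assms(1)[OF step(1)] obtain a where a: "x \<in> free_comp s D a" by blast
  have "vec_hom_part D e (vscale c x + y) = vscale (hom_part (e - a) c) x + vec_hom_part D e y"
  proof
    fix j
    show "vec_hom_part D e (vscale c x + y) j = (vscale (hom_part (e - a) c) x + vec_hom_part D e y) j"
      using hom_part_mult[OF free_comp_coord[OF a, of j], of "e - D j" c]
      by (simp add: vec_hom_part_def hom_part_add pvec_at)
  qed
  then show ?case using step by (simp add: vec.span_add vec.span_scale vec.span_base)
qed

lemma in_span_finite_subset: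
  assumes "v \<in> vec.span G"
  shows "\<exists>T. finite T \<and> T \<subseteq> G \<and> v \<in> vec.span T"
  using assms
proof (induction rule: vec.span_induct_alt)
  case base
  show ?case by (intro exI[of _ "{}"]) simp
next
  case (step c x y)
  then obtain T where T: "finite T" "T \<subseteq> G" "y \<in> vec.span T" by blast
  have "vscale c x + y \<in> vec.span (insert x T)"
    using vec.span_mono[of T "insert x T"] T(3)
    by (intro vec.span_add vec.span_scale) (auto intro: vec.span_base)
  then show ?case using T step(1) by (intro exI[of _ "insert x T"]) auto
qed

lemma span_eq_range_lincomb:
  assumes "bij_betw g {..<r} G0"
  shows "vec.span G0 = lincomb r g ` free_carr r"
proof (intro equalityI subsetI)
  fix v assume "v \<in> vec.span G0"
  moreover have "finite G0" using assms bij_betw_finite by blast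
  ultimately obtain u where u: "v = (\<Sum>x\<in>G0. vscale (u x) x)" using vec.span_finite by auto
  also have "\<dots> = (\<Sum>j<r. vscale (u (g j)) (g j))"
    using sum.reindex_bij_betw[OF assms, of "\<lambda>x. vscale (u x) x"] by simp
  also have "\<dots> = lincomb r g (\<lambda>j. if j < r then u (g j) else 0)"
    by (simp add: lincomb_def)
  finally show "v \<in> lincomb r g ` free_carr r" by auto
next
  fix v assume "v \<in> lincomb r g ` free_carr r"
  then obtain u where "v = (\<Sum>j<r. vscale (u j) (g j))" by (auto simp: lincomb_def)
  moreover have "g j \<in> vec.span G0" if "j < r" for j
    using bij_betwE[OF assms] that by (simp add: vec.span_base)
  ultimately show "v \<in> vec.span G0"
    by (simp only:) (intro vec.span_sum vec.span_scale, simp)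
qed

text \<open>
  Choose a generating subset of \<open>G\<close> of least size. If a coordinate of a syzygy had a nonzero constant
  term, a homogeneous component of the syzygy would have a nonzero constant there, and the
  corresponding generator could be expressed through the others.
\<close>

lemma minimal_generators:
  fixes G :: "('n::finite, 'k::field) pvec set"
  assumes hom: "\<And>x. x \<in> G \<Longrightarrow> \<exists>a. x \<in> free_comp s D a"
  shows "\<exists>r g d. (\<forall>j<r. g j \<in> G \<and> g j \<in> free_comp s D (d j)) \<and>
    lincomb r g ` free_carr r = vec.span G \<and>
    (\<forall>v\<in>free_carr r. lincomb r g v = 0 \<longrightarrow> (\<forall>j. lookup (v j) 0 = 0))"
proof -
  let ?K = "vec.span G"
  have "G \<subseteq> free_carr s" using hom by (auto simp: free_comp_def)
  moreover have "vec.subspace (free_carr s)" by (rule vec.subspaceI) (auto simp: pvec_at)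
  ultimately have "?K \<subseteq> free_carr s" by (rule vec.span_minimal)
  then obtain F where F: "finite F" "F \<subseteq> ?K" "?K \<subseteq> vec.span F"
    using submodule_finitely_generated[of ?K D s] vec_hom_part_in_span[of G s D, OF hom] by auto
  define good where "good = (\<lambda>T. finite T \<and> T \<subseteq> G \<and> vec.span T = ?K)"
  have "\<forall>x\<in>F. \<exists>T. finite T \<and> T \<subseteq> G \<and> x \<in> vec.span T" using F(2) in_span_finite_subset by blast
  then obtain T where T: "\<And>x. x \<in> F \<Longrightarrow> finite (T x) \<and> T x \<subseteq> G \<and> x \<in> vec.span (T x)" by metis
  have "F \<subseteq> vec.span (\<Union>x\<in>F. T x)"
  proof
    fix x assume x: "x \<in> F"
    then show "x \<in> vec.span (\<Union>x\<in>F. T x)"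
      using T[OF x] vec.span_mono[of "T x" "\<Union>x\<in>F. T x"] by auto
  qed
  then have "vec.span F \<subseteq> vec.span (\<Union>x\<in>F. T x)" by (rule vec.span_minimal) simp
  moreover have "vec.span (\<Union>x\<in>F. T x) \<subseteq> ?K" using T by (intro vec.span_mono) auto
  ultimately have "good (\<Union>x\<in>F. T x)" using F T unfolding good_def by blast
  then obtain G0 where G0: "good G0" and least: "\<And>T. good T \<Longrightarrow> card G0 \<le> card T"
    using ex_has_least_nat[of good _ card] by blast
  obtain r where r: "r = card G0" by blast
  obtain g where g: "bij_betw g {..<r} G0"
    using ex_bij_betw_nat_finite[of G0] G0 by (auto simp: good_def r atLeast0LessThan)
  have gG: "g j \<in> G" if "j < r" for j
    using bij_betwE[OF g] G0 that by (auto simp: good_def)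
  then have "\<forall>j. \<exists>a. j < r \<longrightarrow> g j \<in> free_comp s D a" using hom by blast
  then obtain d where d: "\<And>j. j < r \<Longrightarrow> g j \<in> free_comp s D (d j)" by metis
  have "lookup (v i) 0 = 0" if v: "v \<in> free_carr r" and "lincomb r g v = 0" for v i
  proof (rule ccontr)
    assume c: "lookup (v i) 0 \<noteq> 0"
    then have i: "i < r" using v by (metis (mono_tags) lookup_zero mem_Collect_eq not_less)
    define u where "u = vec_hom_part d (d i) v"
    have "lincomb r g u = vec_hom_part D (d i) 0"
      unfolding u_def using vec_hom_part_lincomb[of r g s D d "d i" v, OF d] \<open>lincomb r g v = 0\<close> by simp
    then have 0: "lincomb r g u = 0" by (simp add: vec_hom_part_def fun_eq_iff pvec_at)
    have ui: "u i = single 0 (lookup (v i) 0)"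
      by (simp add: u_def vec_hom_part_def hom_part_0_degree)
    let ?G1 = "G0 - {g i}"
    have "(\<Sum>j\<in>{..<r} - {i}. vscale (u j) (g j)) \<in> vec.span ?G1"
    proof (intro vec.span_sum vec.span_scale vec.span_base)
      fix j assume j: "j \<in> {..<r} - {i}"
      then have "g j \<noteq> g i" using g i by (auto simp: bij_betw_def inj_on_def)
      then show "g j \<in> ?G1" using bij_betwE[OF g] j by auto
    qed
    moreover have "vscale (u i) (g i) + (\<Sum>j\<in>{..<r} - {i}. vscale (u j) (g j)) = 0"
      using 0 i by (simp add: lincomb_def sum.remove[of "{..<r}" i])
    then have "vscale (u i) (g i) = - (\<Sum>j\<in>{..<r} - {i}. vscale (u j) (g j))"
      by (simp add: eq_neg_iff_add_eq_0)
    ultimately have "vscale (u i) (g i) \<in> vec.span ?G1" by (simp add: vec.span_neg)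
    then have "vscale (single 0 (1 / lookup (v i) 0)) (vscale (u i) (g i)) \<in> vec.span ?G1"
      by (rule vec.span_scale)
    then have "g i \<in> vec.span ?G1" using c by (simp add: ui mult_single)
    moreover have "?G1 \<subseteq> vec.span ?G1" by (rule vec.span_superset)
    ultimately have "G0 \<subseteq> vec.span ?G1" by blast
    then have "vec.span G0 \<subseteq> vec.span ?G1" by (rule vec.span_minimal) simp
    then have "good ?G1" using G0 vec.span_mono[of ?G1 G0] by (auto simp: good_def)
    moreover have "card ?G1 < card G0"
      using G0 bij_betwE[OF g] i by (intro psubset_card_mono) (auto simp: good_def)
    ultimately show False using least[of ?G1] by simp
  qed
  moreover have "lincomb r g ` free_carr r = ?K"
    using span_eq_range_lincomb[OF g] G0 by (simp add: good_def)
  ultimately show ?thesis using gG d by (intro exI[of _ r] exI[of _ g] exI[of _ d]) blast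
qed


section \<open>Ideals in nearly disjoint variables\<close>

text \<open>
  A linear relation over \<open>\<Bbbk>[V]\<close> between homogeneous polynomials in \<open>z\<close> and the variables outside \<open>V\<close>.
  Select a monomial of a coefficient \<open>p n0\<close> and keep only the terms of the relation that agree with it
  in the exponents of \<open>V - {z}\<close> and in total degree. As the elements of \<open>N\<close> are homogeneous and free of
  \<open>V - {z}\<close>, each coefficient is reduced to a single term \<open>c n\<close> times \<open>\<alpha> z\<^bsup>k(n)\<^esup>\<close>, with the same monomial
  \<open>\<alpha>\<close> for all \<open>n\<close>. Cancelling the smallest power of \<open>z\<close> that occurs leaves a relation in which some \<open>n1\<close>
  has a constant coefficient. This replaces the freeness of finitely generated torsion-free modules
  over \<open>\<Bbbk>[z]\<close>.
\<close>

lemma monomial_relation_solvable: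
  fixes N :: "('n::finite, 'k::field) mpoly set"
  assumes "finite N" and N: "\<And>n. n \<in> N \<Longrightarrow> homogeneous n" "\<And>n. n \<in> N \<Longrightarrow> n \<in> polys_in (insert z (- V))"
    and "z \<in> V" and p: "\<And>n. n \<in> N \<Longrightarrow> p n \<in> polys_in V"
    and rel: "(\<Sum>n\<in>N. p n * n) = 0" and n0: "n0 \<in> N" "p n0 \<noteq> 0"
  shows "\<exists>n1\<in>N. \<exists>q. (\<forall>n. q n \<in> polys_in V) \<and> n1 = (\<Sum>n\<in>N - {n1}. q n * n)"
proof -
  obtain D where D: "\<And>n. n \<in> N \<Longrightarrow> n \<in> poly_comp (D n)"
    using N(1) unfolding homogeneous_def by metis
  obtain \<mu> where \<mu>: "\<mu> \<in> keys (p n0)"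
    using n0(2) by (metis all_not_in_conv in_keys_iff lookup_zero poly_mapping_eqI)
  define E where "E = int (total_deg \<mu>) + D n0"
  define U where "U = {m :: 'n \<Rightarrow>\<^sub>0 nat. \<forall>i\<in>V - {z}. lookup m i = lookup \<mu> i}"
  define T where "T = U \<inter> {m. int (total_deg m) = E}"
  define T' where "T' = (\<lambda>n. U \<inter> {m. int (total_deg m) = E - D n})"
  define \<alpha> where "\<alpha> = restrict_terms (- {z}) \<mu>"
  define k where "k = (\<lambda>n. nat (E - D n - int (total_deg \<alpha>)))"
  define c where "c = (\<lambda>n. lookup (restrict_terms (T' n) (p n)) (\<alpha> + single z (k n)))"
  have keys\<mu>: "keys \<mu> \<subseteq> V" using p[OF n0(1)] \<mu> by (auto simp: polys_in_iff)
  have restrict: "restrict_terms T (p n * n) = restrict_terms (T' n) (p n) * n" if n: "n \<in> N" for n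
  proof (rule restrict_terms_mult)
    fix m m' assume m': "m' \<in> keys n"
    have "lookup m' i = 0" if "i \<in> V - {z}" for i
    proof -
      have "i \<notin> keys m'" using N(2)[OF n] m' that by (auto simp: polys_in_iff)
      then show ?thesis by (simp add: in_keys_iff)
    qed
    then have "m + m' \<in> U \<longleftrightarrow> m \<in> U" by (simp add: U_def lookup_add)
    moreover have "int (total_deg m') = D n" using D[OF n] m' by (simp add: poly_comp_def)
    ultimately show "m + m' \<in> T \<longleftrightarrow> m \<in> T' n"
      by (auto simp: T_def T'_def total_deg_add)
  qed
  \<comment> \<open>Fixing the total degree and the exponents other than that of \<open>z\<close> leaves one monomial.\<close>
  have unique: "m = \<alpha> + single z (k n)" if "m \<in> T' n" "keys m \<subseteq> V" for m n
  proof -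
    have m: "m = \<alpha> + single z (lookup m z)"
    proof (rule poly_mapping_eqI)
      fix i
      consider "i = z" | "i \<in> V - {z}" | "i \<notin> V" "i \<noteq> z" by blast
      then show "lookup m i = lookup (\<alpha> + single z (lookup m z)) i"
      proof cases
        case 3
        then have "lookup m i = 0" "lookup \<mu> i = 0" using that(2) keys\<mu> by (auto simp: in_keys_iff)
        then show ?thesis using 3
          by (simp add: \<alpha>_def lookup_add lookup_restrict_terms lookup_single when_def)
      qed (use that(1) in \<open>auto simp: \<alpha>_def T'_def U_def lookup_add lookup_restrict_terms lookup_single when_def\<close>)
    qed
    then have "total_deg m = total_deg \<alpha> + lookup m z" by (metis total_deg_add total_deg_single)
    then have "E - D n - int (total_deg \<alpha>) = int (lookup m z)" using that(1) by (simp add: T'_def)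
    then have "lookup m z = k n" by (simp only: k_def nat_int)
    then show ?thesis using m by simp
  qed
  have part: "restrict_terms (T' n) (p n) = single (\<alpha> + single z (k n)) (c n)" if n: "n \<in> N" for n
  proof (rule poly_mapping_eqI)
    fix m
    have "m = \<alpha> + single z (k n)" if "m \<in> keys (restrict_terms (T' n) (p n))"
      using that unique[of m n] p[OF n] by (auto simp: keys_restrict_terms polys_in_iff)
    then show "lookup (restrict_terms (T' n) (p n)) m = lookup (single (\<alpha> + single z (k n)) (c n)) m"
      by (cases "m = \<alpha> + single z (k n)") (auto simp: c_def lookup_single_not_eq in_keys_iff)
  qed
  have "\<mu> \<in> T' n0" by (simp add: T'_def U_def E_def)
  then have "c n0 \<noteq> 0"
    using unique[of \<mu> n0] keys\<mu> \<mu> by (simp add: c_def lookup_restrict_terms in_keys_iff)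
  then obtain n1 where n1: "n1 \<in> N" "c n1 \<noteq> 0" and least: "\<And>n. n \<in> N \<Longrightarrow> c n \<noteq> 0 \<Longrightarrow> k n1 \<le> k n"
    using ex_has_least_nat[of "\<lambda>n. n \<in> N \<and> c n \<noteq> 0" n0 k] n0(1) by auto
  define s where "s = (\<lambda>n. single (single z (k n - k n1)) (c n))"
  have "restrict_terms (T' n) (p n) = single (\<alpha> + single z (k n1)) 1 * s n" if n: "n \<in> N" for n
  proof (cases "c n = 0")
    case True
    then show ?thesis by (simp add: part[OF n] s_def)
  next
    case False
    then have "single z (k n) = single z (k n1) + single z (k n - k n1)"
      using least[OF n] by (simp flip: single_add)
    then show ?thesis by (simp add: part[OF n] s_def mult_single add.assoc)
  qed
  then have "restrict_terms T (\<Sum>n\<in>N. p n * n) = (\<Sum>n\<in>N. single (\<alpha> + single z (k n1)) 1 * s n * n)"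
    by (simp add: restrict_terms_sum restrict)
  then have "single (\<alpha> + single z (k n1)) 1 * (\<Sum>n\<in>N. s n * n) = single (\<alpha> + single z (k n1)) 1 * 0"
    by (simp only: rel sum_distrib_left mult.assoc restrict_terms_0 mult_zero_right)
  then have "(\<Sum>n\<in>N. s n * n) = 0" by (rule single_mult_cancel)
  then have "s n1 * n1 + (\<Sum>n\<in>N - {n1}. s n * n) = 0"
    using \<open>finite N\<close> n1(1) by (simp add: sum.remove)
  then have "s n1 * n1 = - (\<Sum>n\<in>N - {n1}. s n * n)" by (simp add: eq_neg_iff_add_eq_0)
  then have "single 0 (1 / c n1) * (s n1 * n1) = single 0 (1 / c n1) * (- (\<Sum>n\<in>N - {n1}. s n * n))"
    by simp
  moreover have "single 0 (1 / c n1) * (s n1 * n1) = n1"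
    using n1(2) by (simp add: s_def mult_single flip: mult.assoc)
  moreover have "single 0 (1 / c n1) * (- (\<Sum>n\<in>N - {n1}. s n * n))
      = (\<Sum>n\<in>N - {n1}. (- (single 0 (1 / c n1) * s n)) * n)"
    by (simp only: mult_minus_right mult_minus_left sum_distrib_left mult.assoc sum_negf)
  ultimately have "n1 = (\<Sum>n\<in>N - {n1}. (- (single 0 (1 / c n1) * s n)) * n)" by simp
  moreover have "- (single 0 (1 / c n1) * s n) \<in> polys_in V" for n
    using \<open>z \<in> V\<close>
    by (intro polys_in_uminus polys_in_mult) (auto simp: s_def intro!: polys_in_single split: if_splits)
  ultimately show ?thesis
    using n1(1) by (intro bexI[of _ n1] exI[of _ "\<lambda>n. - (single 0 (1 / c n1) * s n)"] conjI) auto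
qed

definition hom_elements_in :: "'n set \<Rightarrow> ('n::finite, 'k::field) mpoly set \<Rightarrow> ('n, 'k) mpoly set" where
  "hom_elements_in Y J = {n \<in> J. homogeneous n \<and> n \<in> polys_in Y}"

text \<open>
  A term times a generator in \<open>\<Bbbk>[Y]\<close> is split by moving the variables outside \<open>V\<close> into the generator,
  which stays in \<open>J \<inter> \<Bbbk>[Y]\<close>, and leaving those of \<open>V\<close> in the coefficient.
\<close>

lemma ideal_element_separated:
  fixes B :: "('n::finite, 'k::field) mpoly set"
  assumes B: "\<forall>b\<in>B. homogeneous b" "B \<subseteq> polys_in Y" "- V \<subseteq> Y" and "p \<in> ideal_gen B"
  shows "\<exists>N w. finite N \<and> N \<subseteq> hom_elements_in Y (ideal_gen B) \<and> (\<forall>n. w n \<in> polys_in V) \<and>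
     p = (\<Sum>n\<in>N. n * w n)"
    (is "?sep p")
proof -
  have add: "?sep (p + q)" if "?sep p" "?sep q" for p q
  proof -
    obtain N w where 1: "finite N" "N \<subseteq> hom_elements_in Y (ideal_gen B)" "\<forall>n. w n \<in> polys_in V"
      "p = (\<Sum>n\<in>N. n * w n)" using \<open>?sep p\<close> by blast
    obtain M u where 2: "finite M" "M \<subseteq> hom_elements_in Y (ideal_gen B)" "\<forall>n. u n \<in> polys_in V"
      "q = (\<Sum>n\<in>M. n * u n)" using \<open>?sep q\<close> by blast
    let ?w = "\<lambda>n. (if n \<in> N then w n else 0) + (if n \<in> M then u n else 0)"
    have "p = (\<Sum>n\<in>N \<union> M. n * (if n \<in> N then w n else 0))"
      unfolding 1(4) using 1(1) 2(1) by (intro sum.mono_neutral_cong_left) auto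
    moreover have "q = (\<Sum>n\<in>N \<union> M. n * (if n \<in> M then u n else 0))"
      unfolding 2(4) using 1(1) 2(1) by (intro sum.mono_neutral_cong_left) auto
    ultimately have "p + q = (\<Sum>n\<in>N \<union> M. n * ?w n)"
      by (simp only: sum.distrib distrib_left)
    moreover have "?w n \<in> polys_in V" for n using 1(3) 2(3) by (simp add: polys_in_add)
    ultimately show ?thesis using 1(1,2) 2(1,2) by (intro exI[of _ "N \<union> M"] exI[of _ ?w]) auto
  qed
  have single_term: "?sep (single m c * b)" if b: "b \<in> B" for m c b
  proof -
    define m1 where "m1 = restrict_terms V m"
    define m2 where "m2 = restrict_terms (- V) m"
    have m: "m = m2 + m1"
      by (rule poly_mapping_eqI) (simp add: m1_def m2_def lookup_add lookup_restrict_terms)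
    have "single m c = single m2 1 * single m1 c" by (simp add: m mult_single)
    then have "single m c * b = (single m2 1 * b) * single m1 c"
      by (simp only: mult.assoc mult.commute[of b])
    moreover have "single m2 1 * b \<in> hom_elements_in Y (ideal_gen B)"
    proof -
      have "single m2 1 * b \<in> ideal_gen B" using b by (intro idl.span_scale idl.span_base)
      moreover have "homogeneous (single m2 1 * b)"
        using B(1) b poly_comp_mult[OF poly_comp_single] unfolding homogeneous_def by blast
      moreover have "single m2 1 * b \<in> polys_in Y"
        using B(2,3) b by (intro polys_in_mult polys_in_single) (auto simp: m2_def keys_restrict_terms)
      ultimately show ?thesis by (simp add: hom_elements_in_def)
    qed
    moreover have "single m1 c \<in> polys_in V"
      by (intro polys_in_single) (simp add: m1_def keys_restrict_terms)
    ultimately show ?thesis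
      by (intro exI[of _ "{single m2 1 * b}"] exI[of _ "\<lambda>_. single m1 c"]) simp
  qed
  have zero: "?sep 0" by (intro exI[of _ "{}"] exI[of _ "\<lambda>_. 0"]) simp
  have sum: "?sep (sum f A)" if "finite A" "\<And>a. a \<in> A \<Longrightarrow> ?sep (f a)" for f and A :: "('n \<Rightarrow>\<^sub>0 nat) set"
    using that
  proof (induction A)
    case (insert x A)
    have "?sep (f x + sum f A)" by (rule add) (use insert in auto)
    then show ?case using insert(1,2) by simp
  qed (use zero in simp)
  show ?thesis
    using \<open>p \<in> ideal_gen B\<close>
  proof (induction rule: idl.span_induct_alt)
    case base
    show ?case by (rule zero)
  next
    case (step c x y)
    have "c * x = (\<Sum>m\<in>keys c. single m (lookup c m) * x)"
      using arg_cong[OF sum_singles[of c], of "\<lambda>c. c * x"] by (simp only: sum_distrib_right)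
    moreover have "?sep (\<Sum>m\<in>keys c. single m (lookup c m) * x)"
      using step(1) by (intro sum single_term) auto
    ultimately have "?sep (c * x)" by simp
    then show ?case by (rule add[OF _ step(2)])
  qed
qed

lemma vec_separated:
  fixes B :: "('n::finite, 'k::field) mpoly set"
  assumes B: "\<forall>b\<in>B. homogeneous b" "B \<subseteq> polys_in Y" "- V \<subseteq> Y"
    and v: "v \<in> free_carr r" "\<And>j. v j \<in> ideal_gen B"
  shows "\<exists>N w. finite N \<and> N \<subseteq> hom_elements_in Y (ideal_gen B) \<and> (\<forall>n j. w n j \<in> polys_in V) \<and>
     (\<forall>n. w n \<in> free_carr r) \<and> v = (\<Sum>n\<in>N. vscale n (w n))"
proof -
  define sep where "sep = (\<lambda>j N w. finite N \<and> N \<subseteq> hom_elements_in Y (ideal_gen B) \<and>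
     (\<forall>n. w n \<in> polys_in V) \<and> v j = (\<Sum>n\<in>N. n * w n))"
  have "\<forall>j. \<exists>N w. sep j N w"
    unfolding sep_def using ideal_element_separated[OF B v(2)] by (rule allI)
  then obtain N w where "\<And>j. sep j (N j) (w j)" by metis
  then have Nw: "\<And>j. finite (N j)" "\<And>j. N j \<subseteq> hom_elements_in Y (ideal_gen B)"
    "\<And>j n. w j n \<in> polys_in V" "\<And>j. v j = (\<Sum>n\<in>N j. n * w j n)"
    unfolding sep_def by (elim meta_allE conjE; simp)+
  let ?N = "\<Union>j<r. N j"
  let ?w = "\<lambda>n j. if j < r \<and> n \<in> N j then w j n else 0"
  have "v = (\<Sum>n\<in>?N. vscale n (?w n))"
  proof
    fix j
    show "v j = (\<Sum>n\<in>?N. vscale n (?w n)) j"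
    proof (cases "j < r")
      case True
      have "(\<Sum>n\<in>N j. n * w j n) = (\<Sum>n\<in>?N. n * ?w n j)"
        using True Nw(1) by (intro sum.mono_neutral_cong_left) auto
      then show ?thesis using Nw(4)[of j] by (simp add: pvec_at)
    next
      case False
      then show ?thesis using v(1) by (simp add: pvec_at)
    qed
  qed
  moreover have "finite ?N" "?N \<subseteq> hom_elements_in Y (ideal_gen B)" using Nw(1,2) by auto
  moreover have "\<forall>n j. ?w n j \<in> polys_in V" using Nw(3) by simp
  moreover have "\<forall>n. ?w n \<in> free_carr r" by simp
  ultimately show ?thesis by (intro exI[of _ ?N] exI[of _ ?w] conjI)
qed

text \<open>
  Flatness of the ideal \<open>J\<close> generated by \<open>B\<close> with respect to matrices over \<open>\<Bbbk>[V]\<close>: syzygies with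
  coordinates in \<open>J\<close> come from \<open>J \<otimes> Syz(g)\<close>. In a representation \<open>v = \<Sum> n w\<^sub>n\<close> with the fewest \<open>n \<in> J \<inter> \<Bbbk>[Y]\<close>, all \<open>w\<^sub>n\<close> are syzygies:
  otherwise a coordinate of \<open>\<Sum> n g(w\<^sub>n) = 0\<close> is a nontrivial relation, one \<open>n\<close> is a combination of the
  others, and substituting it shortens the representation.
\<close>

lemma syzygies_over_ideal:
  fixes B :: "('n::finite, 'k::field) mpoly set"
  assumes B: "\<forall>b\<in>B. homogeneous b" "B \<subseteq> polys_in (insert z (- V))" and z: "z \<in> V"
    and g: "\<forall>j<r. \<forall>i. g j i \<in> polys_in V"
    and v: "v \<in> free_carr r" "\<And>j. v j \<in> ideal_gen B" "lincomb r g v = 0"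
  shows "\<exists>N w. finite N \<and> N \<subseteq> ideal_gen B \<and> v = (\<Sum>n\<in>N. vscale n (w n)) \<and>
     (\<forall>n\<in>N. w n \<in> free_carr r \<and> (\<forall>j. w n j \<in> polys_in V) \<and> lincomb r g (w n) = 0)"
proof -
  define rep where "rep = (\<lambda>N. finite N \<and> N \<subseteq> hom_elements_in (insert z (- V)) (ideal_gen B) \<and>
     (\<exists>w. (\<forall>n j. w n j \<in> polys_in V) \<and> (\<forall>n. w n \<in> free_carr r) \<and> v = (\<Sum>n\<in>N. vscale n (w n))))"
  obtain N0 w0 where "finite N0" "N0 \<subseteq> hom_elements_in (insert z (- V)) (ideal_gen B)"
    "\<forall>n j. w0 n j \<in> polys_in V" "\<forall>n. w0 n \<in> free_carr r" "v = (\<Sum>n\<in>N0. vscale n (w0 n))"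
    using vec_separated[OF B subset_insertI v(1,2)] by (elim exE conjE)
  then have "rep N0" unfolding rep_def by (intro conjI exI[of _ w0])
  then obtain N where N: "rep N" and least: "\<And>M. rep M \<Longrightarrow> card N \<le> card M"
    using ex_has_least_nat[of rep N0 card] by blast
  then obtain w where w: "\<And>n j. w n j \<in> polys_in V" "\<And>n. w n \<in> free_carr r"
    and vw: "v = (\<Sum>n\<in>N. vscale n (w n))" and "finite N"
    and NJ: "N \<subseteq> hom_elements_in (insert z (- V)) (ideal_gen B)"
    unfolding rep_def by blast
  have "lincomb r g (w n0) = 0" if n0: "n0 \<in> N" for n0
  proof (rule ccontr)
    assume "lincomb r g (w n0) \<noteq> 0"
    then obtain i where i: "lincomb r g (w n0) i \<noteq> 0" by (auto simp: fun_eq_iff pvec_at)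
    let ?p = "\<lambda>n. lincomb r g (w n) i"
    have "lincomb r g v = (\<Sum>n\<in>N. vscale n (lincomb r g (w n)))"
      by (simp add: vw pvec_linear_sum[OF pvec_linear_lincomb_map] pvec_linear_scale[OF pvec_linear_lincomb_map])
    then have "(\<Sum>n\<in>N. vscale n (lincomb r g (w n))) i = 0" using v(3) by (simp add: zero_fun_apply)
    then have rel: "(\<Sum>n\<in>N. ?p n * n) = 0" by (simp add: pvec_at mult.commute)
    have pV: "?p n \<in> polys_in V" for n
      unfolding lincomb_at using w(1) g by (intro polys_in_sum polys_in_mult) auto
    have "\<exists>n1\<in>N. \<exists>q. (\<forall>n. q n \<in> polys_in V) \<and> n1 = (\<Sum>n\<in>N - {n1}. q n * n)"
    proof (rule monomial_relation_solvable[OF \<open>finite N\<close> _ _ z _ rel n0 i])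
      show "homogeneous n" "n \<in> polys_in (insert z (- V))" if "n \<in> N" for n
        using NJ that by (auto simp: hom_elements_in_def)
    qed (rule pV)
    then obtain n1 q where n1: "n1 \<in> N" and q: "\<And>n. q n \<in> polys_in V"
      and n1q: "n1 = (\<Sum>n\<in>N - {n1}. q n * n)"
      by blast
    let ?w = "\<lambda>n. w n + vscale (q n) (w n1)"
    have "v = vscale n1 (w n1) + (\<Sum>n\<in>N - {n1}. vscale n (w n))"
      using vw \<open>finite N\<close> n1 by (simp add: sum.remove)
    also have "vscale n1 (w n1) = vscale (\<Sum>n\<in>N - {n1}. q n * n) (w n1)"
      using n1q by simp
    also have "\<dots> = (\<Sum>n\<in>N - {n1}. vscale n (vscale (q n) (w n1)))"
      by (simp add: vec.scale_sum_left mult.commute)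
    finally have "v = (\<Sum>n\<in>N - {n1}. vscale n (?w n))"
      by (simp add: vec.scale_right_distrib sum.distrib add.commute)
    moreover have "\<forall>n j. ?w n j \<in> polys_in V"
      using w(1) q by (auto simp: pvec_at intro!: polys_in_add polys_in_mult)
    moreover have "\<forall>n. ?w n \<in> free_carr r" using w(2) by (simp add: pvec_at)
    ultimately have "rep (N - {n1})"
      unfolding rep_def using \<open>finite N\<close> NJ by (intro conjI exI[of _ ?w]) (simp, blast, assumption+)
    then show False using least[of "N - {n1}"] n1 \<open>finite N\<close> card_Diff1_less[of N n1] by simp
  qed
  moreover have "N \<subseteq> ideal_gen B" using NJ by (auto simp: hom_elements_in_def)
  ultimately show ?thesis
    using \<open>finite N\<close> vw w by (intro exI[of _ N] exI[of _ w] conjI ballI allI)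
qed


section \<open>Minimal resolutions over a subset of the variables\<close>

lemma free_carr_subspace: "vec.subspace (free_carr r)"
  by (rule vec.subspaceI) (auto simp: pvec_at)

lemma syz_subspace: "vec.subspace {v \<in> free_carr s. lincomb s g v = 0}"
  by (rule vec.subspaceI)
    (auto simp: pvec_at pvec_linear_add[OF pvec_linear_lincomb_map] pvec_linear_0
      pvec_linear_scale[OF pvec_linear_lincomb_map])

text \<open>
  Over all of \<open>S\<close>, regarded as the unit ideal, the syzygies of vectors over \<open>\<Bbbk>[V]\<close> are generated by
  homogeneous syzygies over \<open>\<Bbbk>[V]\<close>; a minimal generating set is chosen among these.
\<close>

lemma next_syzygies:
  fixes g :: "nat \<Rightarrow> ('n::finite, 'k::field) pvec"
  assumes "\<forall>j<s. \<forall>i. g j i \<in> polys_in V" and "\<forall>j<s. g j \<in> free_comp s' D' (D j)"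
    and "V \<noteq> {}"
  shows "\<exists>r g' d. (\<forall>j<r. (\<forall>i. g' j i \<in> polys_in V) \<and> g' j \<in> free_comp s D (d j)) \<and>
    lincomb r g' ` free_carr r = {v \<in> free_carr s. lincomb s g v = 0} \<and>
    (\<forall>v\<in>free_carr r. lincomb r g' v = 0 \<longrightarrow> (\<forall>j. lookup (v j) 0 = 0))"
proof -
  have hom: "\<And>j. j < s \<Longrightarrow> g j \<in> free_comp s' D' (D j)"
    using assms(2) by blast
  define G where "G = {x. (\<exists>a. x \<in> syz_comp s g D a) \<and> (\<forall>i. x i \<in> polys_in V)}"
  let ?Z = "{v \<in> free_carr s. lincomb s g v = 0}"
  obtain z where z: "z \<in> V" using \<open>V \<noteq> {}\<close> by blast
  have span: "vec.span G = ?Z"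
  proof
    have "G \<subseteq> ?Z" by (auto simp: G_def syz_comp_def free_comp_def)
    then show "vec.span G \<subseteq> ?Z" by (rule vec.span_minimal[OF _ syz_subspace])
    show "?Z \<subseteq> vec.span G"
    proof
      fix v assume v: "v \<in> ?Z"
      have "homogeneous (1 :: ('n, 'k) mpoly)" unfolding homogeneous_def using poly_comp_1 by blast
      moreover have "ideal_gen {1 :: ('n, 'k) mpoly} = UNIV" by (auto simp: idl.span_singleton)
      ultimately obtain N w where "v = (\<Sum>n\<in>N. vscale n (w n))"
        and w: "\<And>n. n \<in> N \<Longrightarrow> w n \<in> free_carr s \<and> (\<forall>j. w n j \<in> polys_in V) \<and> lincomb s g (w n) = 0"
        using syzygies_over_ideal[of "{1}" z V s g v, OF _ _ z assms(1)] v by auto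
      moreover have "w n \<in> vec.span G" if "n \<in> N" for n
      proof -
        have wn: "w n \<in> free_carr s" "\<And>j. w n j \<in> polys_in V" "lincomb s g (w n) = 0"
          using w[OF that] by auto
        obtain E where "finite E" and E: "(\<Sum>e\<in>E. vec_hom_part D e (w n)) = w n"
          by (rule vec_hom_part_sum_degrees[OF wn(1)])
        have "vec_hom_part D e (w n) \<in> G" for e
        proof -
          have "lincomb s g (vec_hom_part D e (w n)) = vec_hom_part D' e (lincomb s g (w n))"
            using vec_hom_part_lincomb[of s g s' D' D, OF hom] by simp
          also have "\<dots> = 0" by (simp add: wn(3) vec_hom_part_def fun_eq_iff pvec_at)
          finally show ?thesis
            using wn(2) vec_hom_part_in[OF wn(1), of D e] unfolding G_def syz_comp_def
            by (auto simp: vec_hom_part_def intro: polys_in_hom_part)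
        qed
        then have "(\<Sum>e\<in>E. vec_hom_part D e (w n)) \<in> vec.span G"
          by (intro vec.span_sum vec.span_base)
        then show ?thesis by (simp only: E)
      qed
      ultimately show "v \<in> vec.span G" by (simp only:) (intro vec.span_sum vec.span_scale, simp)
    qed
  qed
  have "\<exists>a. x \<in> free_comp s D a" if "x \<in> G" for x using that by (auto simp: G_def syz_comp_def)
  then obtain r g' d where *: "\<forall>j<r. g' j \<in> G \<and> g' j \<in> free_comp s D (d j)"
    "lincomb r g' ` free_carr r = vec.span G"
    "\<forall>v\<in>free_carr r. lincomb r g' v = 0 \<longrightarrow> (\<forall>j. lookup (v j) 0 = 0)"
    using minimal_generators[of G s D] by blast
  show ?thesis
    using * unfolding span by (intro exI[of _ r] exI[of _ g'] exI[of _ d]) (simp add: G_def)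
qed

text \<open>
  Ideals are treated as submodules of \<open>S\<^sup>1\<close>.
\<close>

definition emb :: "('n, 'k::field) mpoly \<Rightarrow> ('n, 'k) pvec" where
  "emb p = (\<lambda>j. if j = 0 then p else 0)"

lemma emb_at_0 [simp]: "emb p 0 = p" by (simp add: emb_def)

lemma emb_inject [simp]: "emb p = emb q \<longleftrightarrow> p = q" by (metis emb_at_0)

lemma emb_0 [simp]: "emb 0 = 0" by (simp add: emb_def fun_eq_iff pvec_at)

lemma emb_add: "emb (p + q) = emb p + emb q" by (simp add: emb_def fun_eq_iff pvec_at)

lemma emb_scale: "emb (c * p) = vscale c (emb p)" by (simp add: emb_def fun_eq_iff pvec_at)

lemma emb_sum: "emb (sum f A) = (\<Sum>a\<in>A. emb (f a))"
  by (induction A rule: infinite_finite_induct) (simp_all add: emb_add)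

lemma emb_free_comp: "emb p \<in> free_comp 1 (\<lambda>_. 0) e \<longleftrightarrow> p \<in> poly_comp e"
  by (simp add: free_comp_def emb_def)

lemma free_carr_1: "v \<in> free_carr 1 \<Longrightarrow> v = emb (v 0)"
  by (auto simp: emb_def fun_eq_iff)

lemma span_emb: "vec.span (emb ` A) = emb ` ideal_gen A"
proof -
  have "module_hom (*) vscale (emb :: ('a, 'b) mpoly \<Rightarrow> _)"
    by unfold_locales (simp_all add: emb_add emb_scale)
  then show ?thesis by (rule module_hom.span_image)
qed

text \<open>
  Minimal graded free resolutions of \<open>I\<close> given by their matrices: the columns of the \<open>i\<close>-th one are
  \<open>g i 0, \<dots>, g i (r i - 1)\<close>, and the matrix \<open>g 0\<close> is the augmentation.
\<close>

definition pvec_resolution :: "('n::finite, 'k::field) mpoly set \<Rightarrow> (nat \<Rightarrow> nat) \<Rightarrow>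
    (nat \<Rightarrow> nat \<Rightarrow> int) \<Rightarrow> (nat \<Rightarrow> nat \<Rightarrow> ('n, 'k) pvec) \<Rightarrow> bool" where
  "pvec_resolution I r d g \<longleftrightarrow>
     (\<forall>j<r 0. g 0 j \<in> free_comp 1 (\<lambda>_. 0) (d 0 j)) \<and>
     (\<forall>i. \<forall>j<r (Suc i). g (Suc i) j \<in> free_comp (r i) (d i) (d (Suc i) j)) \<and>
     lincomb (r 0) (g 0) ` free_carr (r 0) = emb ` I \<and>
     (\<forall>i. lincomb (r (Suc i)) (g (Suc i)) ` free_carr (r (Suc i))
        = {v \<in> free_carr (r i). lincomb (r i) (g i) v = 0}) \<and>
     (\<forall>i. \<forall>v\<in>free_carr (r i). lincomb (r i) (g i) v = 0 \<longrightarrow> (\<forall>j. lookup (v j) 0 = 0))"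

lemma pvec_resolution_exists:
  fixes A :: "('n::finite, 'k::field) mpoly set"
  assumes A: "\<forall>p\<in>A. homogeneous p" "A \<subseteq> polys_in V" and "V \<noteq> {}"
  obtains r d g where "pvec_resolution (ideal_gen A) r d g"
    "\<And>i j k. j < r i \<Longrightarrow> g i j k \<in> polys_in V"
proof -
  have "\<exists>a. x \<in> free_comp 1 (\<lambda>_. 0) a" if "x \<in> emb ` A" for x
    using A(1) that unfolding homogeneous_def by (auto simp: emb_free_comp simp del: One_nat_def)
  then obtain r0 g0 d0 where 0: "\<forall>j<r0. g0 j \<in> emb ` A \<and> g0 j \<in> free_comp 1 (\<lambda>_. 0) (d0 j)"
    "lincomb r0 g0 ` free_carr r0 = vec.span (emb ` A)"
    "\<forall>v\<in>free_carr r0. lincomb r0 g0 v = 0 \<longrightarrow> (\<forall>j. lookup (v j) 0 = 0)"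
    using minimal_generators[of "emb ` A" 1 "\<lambda>_. 0"] by blast
  define P :: "nat \<Rightarrow> nat \<times> (nat \<Rightarrow> ('n, 'k) pvec) \<times> (nat \<Rightarrow> int) \<Rightarrow> bool" where
    "P = (\<lambda>i (s, g, D). (\<exists>s' D'. \<forall>j<s. g j \<in> free_comp s' D' (D j)) \<and> (\<forall>j<s. \<forall>k. g j k \<in> polys_in V)
      \<and> (\<forall>v\<in>free_carr s. lincomb s g v = 0 \<longrightarrow> (\<forall>j. lookup (v j) 0 = 0))
      \<and> (i = 0 \<longrightarrow> s = r0 \<and> g = g0 \<and> D = d0))"
  define Q :: "nat \<Rightarrow> nat \<times> (nat \<Rightarrow> ('n, 'k) pvec) \<times> (nat \<Rightarrow> int) \<Rightarrow>
      nat \<times> (nat \<Rightarrow> ('n, 'k) pvec) \<times> (nat \<Rightarrow> int) \<Rightarrow> bool" where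
    "Q = (\<lambda>i (s, g, D) (r, g', d). (\<forall>j<r. g' j \<in> free_comp s D (d j))
      \<and> lincomb r g' ` free_carr r = {v \<in> free_carr s. lincomb s g v = 0})"
  have "\<exists>x. P 0 x"
  proof
    have "g0 j k \<in> polys_in V" if "j < r0" for j k
    proof -
      have "g0 j \<in> emb ` A" using 0(1) that by blast
      then show ?thesis using A(2) by (auto simp: emb_def)
    qed
    then show "P 0 (r0, g0, d0)" unfolding P_def using 0(1,3) by blast
  qed
  moreover have "\<exists>y. P (Suc i) y \<and> Q i x y" if Px: "P i x" for x i
  proof -
    obtain s g D where x: "x = (s, g, D)" by (metis prod_cases3)
    obtain s' D' where hom: "\<forall>j<s. g j \<in> free_comp s' D' (D j)"
      and gV: "\<forall>j<s. \<forall>k. g j k \<in> polys_in V"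
      using Px by (auto simp: x P_def)
    from next_syzygies[OF gV hom \<open>V \<noteq> {}\<close>]
    obtain r g' d where g': "\<forall>j<r. (\<forall>i. g' j i \<in> polys_in V) \<and> g' j \<in> free_comp s D (d j)"
      "lincomb r g' ` free_carr r = {v \<in> free_carr s. lincomb s g v = 0}"
      "\<forall>v\<in>free_carr r. lincomb r g' v = 0 \<longrightarrow> (\<forall>j. lookup (v j) 0 = 0)"
      by (elim exE conjE)
    have "\<forall>j<r. g' j \<in> free_comp s D (d j)" "\<forall>j<r. \<forall>k. g' j k \<in> polys_in V" using g'(1) by auto
    then have "P (Suc i) (r, g', d)"
      unfolding P_def prod.case using g'(3) by (intro conjI exI[of _ s] exI[of _ D]) simp_all
    moreover have "Q i x (r, g', d)" unfolding x Q_def using g'(1,2) by simp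
    ultimately show ?thesis by blast
  qed
  ultimately have "\<exists>X. \<forall>i. P i (X i) \<and> Q i (X i) (X (Suc i))"
    by (rule dependent_nat_choice)
  then obtain X where X: "\<And>i. P i (X i)" "\<And>i. Q i (X i) (X (Suc i))"
    by blast
  define r where "r = (\<lambda>i. fst (X i))"
  define g where "g = (\<lambda>i. fst (snd (X i)))"
  define d where "d = (\<lambda>i. snd (snd (X i)))"
  have X_eq: "X i = (r i, g i, d i)" for i by (simp add: r_def g_def d_def)
  have "r 0 = r0" "g 0 = g0" "d 0 = d0" using X(1)[of 0] by (auto simp: X_eq P_def)
  then have "pvec_resolution (ideal_gen A) r d g"
    unfolding pvec_resolution_def
    using 0(1,2) X unfolding X_eq P_def Q_def by (auto simp: span_emb)
  moreover have "g i j k \<in> polys_in V" if "j < r i" for i j k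
    using X(1)[of i] that by (auto simp: X_eq P_def)
  ultimately show thesis using that by blast
qed


section \<open>Resolutions of ideals and their degrees\<close>

lemma
  assumes "pvec_resolution I r d g"
  shows pvec_resolution_gens_0: "j < r 0 \<Longrightarrow> g 0 j \<in> free_comp 1 (\<lambda>_. 0) (d 0 j)"
    and pvec_resolution_gens_Suc: "j < r (Suc i) \<Longrightarrow> g (Suc i) j \<in> free_comp (r i) (d i) (d (Suc i) j)"
    and pvec_resolution_image_0: "lincomb (r 0) (g 0) ` free_carr (r 0) = emb ` I"
    and pvec_resolution_image_Suc: "lincomb (r (Suc i)) (g (Suc i)) ` free_carr (r (Suc i))
        = {v \<in> free_carr (r i). lincomb (r i) (g i) v = 0}"
    and pvec_resolution_minimal: "v \<in> free_carr (r i) \<Longrightarrow> lincomb (r i) (g i) v = 0 \<Longrightarrow> lookup (v j) 0 = 0"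
  using assms unfolding pvec_resolution_def by simp_all

lemma free_module_simps:
  "carr (free_module r d) = free_carr r" "gscale (free_module r d) = vscale"
  "gcomp (free_module r d) = free_comp r d"
  by (auto simp: free_module_def free_comp_def vscale_def fun_eq_iff)

lemma ideal_module_simps:
  "carr (ideal_module I) = I" "gscale (ideal_module I) = (*)"
  "gcomp (ideal_module I) e = I \<inter> poly_comp e"
  by (simp_all add: ideal_module_def)

lemma lincomb_free_comp:
  assumes "\<And>j. j < r \<Longrightarrow> g j \<in> free_comp s D (d j)" "v \<in> free_comp r d e"
  shows "lincomb r g v \<in> free_comp s D e"
  by (rule graded_family_lincomb[OF graded_family_free assms])

lemma pvec_resolution_imp_minimal_resolution:
  assumes res: "pvec_resolution I r d g"
  shows "minimal_graded_free_resolution (ideal_module I) r d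
    (\<lambda>i. lincomb (r (Suc i)) (g (Suc i))) (\<lambda>v. lincomb (r 0) (g 0) v 0)"
proof -
  note im0 = pvec_resolution_image_0[OF res] and imS = pvec_resolution_image_Suc[OF res]
  have in_emb: "lincomb (r 0) (g 0) v \<in> emb ` I" if "v \<in> free_carr (r 0)" for v
    using im0 that by blast
  have "(\<lambda>v. lincomb (r 0) (g 0) v 0) ` free_carr (r 0) = (\<lambda>w. w 0) ` lincomb (r 0) (g 0) ` free_carr (r 0)"
    by (simp add: image_image)
  also have "\<dots> = I" by (simp only: im0 image_image emb_at_0) simp
  finally have onto: "(\<lambda>v. lincomb (r 0) (g 0) v 0) ` free_carr (r 0) = I" .
  have hom0: "graded_hom (free_module (r 0) (d 0)) (ideal_module I) (\<lambda>v. lincomb (r 0) (g 0) v 0)"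
    unfolding graded_hom_def free_module_simps ideal_module_simps
  proof (intro conjI allI ballI)
    show "(\<lambda>v. lincomb (r 0) (g 0) v 0) ` free_carr (r 0) \<subseteq> I" using onto by simp
    show "(\<lambda>v. lincomb (r 0) (g 0) v 0) ` free_comp (r 0) (d 0) e \<subseteq> I \<inter> poly_comp e" for e
    proof
      fix p assume "p \<in> (\<lambda>v. lincomb (r 0) (g 0) v 0) ` free_comp (r 0) (d 0) e"
      then obtain v where v: "v \<in> free_comp (r 0) (d 0) e" "p = lincomb (r 0) (g 0) v 0" by auto
      have "v \<in> free_carr (r 0)" using v(1) by (simp add: free_comp_def)
      then have "p \<in> I" using onto v(2) by blast
      moreover have "lincomb (r 0) (g 0) v \<in> free_comp 1 (\<lambda>_. 0) e"
        by (rule lincomb_free_comp[OF pvec_resolution_gens_0[OF res] v(1)])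
      then have "p \<in> poly_comp e" using v(2) free_comp_coord by fastforce
      ultimately show "p \<in> I \<inter> poly_comp e" by simp
    qed
  qed (simp_all add: pvec_linear_add[OF pvec_linear_lincomb_map] pvec_linear_scale[OF pvec_linear_lincomb_map] pvec_at)
  have homS: "graded_hom (free_module (r (Suc i)) (d (Suc i))) (free_module (r i) (d i))
      (lincomb (r (Suc i)) (g (Suc i)))" for i
    unfolding graded_hom_def free_module_simps
  proof (intro conjI allI ballI)
    show "lincomb (r (Suc i)) (g (Suc i)) ` free_carr (r (Suc i)) \<subseteq> free_carr (r i)"
      using imS by blast
    show "lincomb (r (Suc i)) (g (Suc i)) ` free_comp (r (Suc i)) (d (Suc i)) e \<subseteq> free_comp (r i) (d i) e" for e
      by (rule image_subsetI) (rule lincomb_free_comp[OF pvec_resolution_gens_Suc[OF res]])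
  qed (simp_all add: pvec_linear_add[OF pvec_linear_lincomb_map] pvec_linear_scale[OF pvec_linear_lincomb_map])
  have ker0: "{v \<in> free_carr (r 0). lincomb (r 0) (g 0) v 0 = 0} = {v \<in> free_carr (r 0). lincomb (r 0) (g 0) v = 0}"
  proof -
    have "lincomb (r 0) (g 0) v 0 = 0 \<longleftrightarrow> lincomb (r 0) (g 0) v = 0" if v: "v \<in> free_carr (r 0)" for v
    proof -
      obtain p where "lincomb (r 0) (g 0) v = emb p" using in_emb[OF v] by blast
      then show ?thesis using emb_inject[of p 0] by simp
    qed
    then show ?thesis by blast
  qed
  have "graded_free_resolution (ideal_module I) r d (\<lambda>i. lincomb (r (Suc i)) (g (Suc i)))
      (\<lambda>v. lincomb (r 0) (g 0) v 0)"
    unfolding graded_free_resolution_def Let_def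
    using hom0 homS onto ker0 imS[of 0] imS unfolding free_module_simps ideal_module_simps
    by (simp only: One_nat_def simp_thms)
  moreover have "lincomb (r (Suc i)) (g (Suc i)) v j \<in> irrelevant_ideal"
    if v: "v \<in> free_carr (r (Suc i))" for i v j
  proof -
    have "lincomb (r (Suc i)) (g (Suc i)) v \<in> {v \<in> free_carr (r i). lincomb (r i) (g i) v = 0}"
      using v imS[of i] by blast
    then show ?thesis unfolding in_irrelevant_ideal_iff using pvec_resolution_minimal[OF res] by blast
  qed
  ultimately show ?thesis
    unfolding minimal_graded_free_resolution_def free_module_simps by blast
qed

text \<open>
  The homomorphisms of a given resolution are determined only on the carriers of the free modules;
  there they coincide with the everywhere linear maps given by the images of the basis vectors.
\<close>

lemma graded_hom_free_module:
  fixes M :: "(('n::finite, 'k::field) mpoly, 'b::ab_group_add) graded_module"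
  assumes f: "graded_hom (free_module r d) M f" and v: "v \<in> free_carr r"
  shows "f v = (\<Sum>j<r. gscale M (v j) (f (unit_vec j)))"
proof -
  have add: "f (u + w) = f u + f w" if "u \<in> free_carr r" "w \<in> free_carr r" for u w
    using f that unfolding graded_hom_def free_module_simps by blast
  have scale: "f (vscale p w) = gscale M p (f w)" if "w \<in> free_carr r" for p w
    using f that unfolding graded_hom_def free_module_simps by blast
  have zero: "0 \<in> free_carr r" by (rule vec.subspace_0[OF free_carr_subspace])
  have "f 0 = 0" using add[OF zero zero] by simp
  have unit: "unit_vec j \<in> free_carr r" if "j < r" for j using that by (simp add: unit_vec_def)
  have "f (\<Sum>j<k. vscale (v j) (unit_vec j)) = (\<Sum>j<k. gscale M (v j) (f (unit_vec j)))" if "k \<le> r" for k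
    using that
  proof (induction k)
    case (Suc k)
    have "(\<Sum>j<k. vscale (v j) (unit_vec j)) \<in> free_carr r"
      using Suc.prems by (intro vec.subspace_sum[OF free_carr_subspace] vec.subspace_scale[OF free_carr_subspace] unit) auto
    moreover have "vscale (v k) (unit_vec k) \<in> free_carr r"
      using Suc.prems by (intro vec.subspace_scale[OF free_carr_subspace] unit) auto
    moreover have "f (vscale (v k) (unit_vec k)) = gscale M (v k) (f (unit_vec k))"
      using Suc.prems by (intro scale unit) simp
    ultimately show ?case using Suc by (simp add: add)
  qed (simp add: \<open>f 0 = 0\<close>)
  from this[of r] show ?thesis using free_carr_eq_lincomb[OF v] by (simp add: lincomb_def)
qed

lemma minimal_resolution_imp_pvec_resolution:
  assumes "minimal_graded_free_resolution (ideal_module I) r d \<delta> \<epsilon>"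
  obtains g where "pvec_resolution I r d g"
proof -
  have *: "graded_hom (free_module (r 0) (d 0)) (ideal_module I) \<epsilon>" "\<epsilon> ` free_carr (r 0) = I"
    "\<forall>i. graded_hom (free_module (r (Suc i)) (d (Suc i))) (free_module (r i) (d i)) (\<delta> i)"
    "\<delta> 0 ` free_carr (r 1) = {v \<in> free_carr (r 0). \<epsilon> v = 0}"
    "\<forall>i. \<delta> (Suc i) ` free_carr (r (Suc (Suc i))) = {v \<in> free_carr (r (Suc i)). \<delta> i v = 0}"
    "\<forall>i. \<forall>v\<in>free_carr (r (Suc i)). \<forall>j. \<delta> i v j \<in> irrelevant_ideal"
    using assms unfolding minimal_graded_free_resolution_def graded_free_resolution_def Let_def
      free_module_simps ideal_module_simps by - (elim conjE, assumption)+
  note res = *(1,2) *(3)[THEN spec] *(4) *(5)[THEN spec] and min = *(6)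
  define g where "g = (\<lambda>i j. case i of 0 \<Rightarrow> emb (\<epsilon> (unit_vec j)) | Suc i \<Rightarrow> \<delta> i (unit_vec j))"
  have g0: "lincomb (r 0) (g 0) v = emb (\<epsilon> v)" if "v \<in> free_carr (r 0)" for v
    unfolding graded_hom_free_module[OF res(1) that] ideal_module_simps
    by (simp add: lincomb_def g_def emb_sum emb_scale)
  have gS: "lincomb (r (Suc i)) (g (Suc i)) v = \<delta> i v" if "v \<in> free_carr (r (Suc i))" for i v
    unfolding graded_hom_free_module[OF res(3) that] free_module_simps
    by (simp add: lincomb_def g_def)
  have im0: "lincomb (r 0) (g 0) ` free_carr (r 0) = emb ` I"
  proof -
    have "lincomb (r 0) (g 0) ` free_carr (r 0) = emb ` \<epsilon> ` free_carr (r 0)"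
      unfolding image_image by (rule image_cong[OF refl g0])
    then show ?thesis by (simp only: res(2))
  qed
  have ker: "{v \<in> free_carr (r i). lincomb (r i) (g i) v = 0} = \<delta> i ` free_carr (r (Suc i))" for i
  proof (cases i)
    case 0
    have "emb (\<epsilon> v) = 0 \<longleftrightarrow> \<epsilon> v = 0" for v using emb_inject[of "\<epsilon> v" 0] by simp
    then have "{v \<in> free_carr (r 0). lincomb (r 0) (g 0) v = 0} = {v \<in> free_carr (r 0). \<epsilon> v = 0}"
      using g0 by auto
    then show ?thesis using res(4) 0 by simp
  next
    case (Suc k)
    have "{v \<in> free_carr (r (Suc k)). lincomb (r (Suc k)) (g (Suc k)) v = 0} = {v \<in> free_carr (r (Suc k)). \<delta> k v = 0}"
      using gS by auto
    then show ?thesis using res(5) Suc by simp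
  qed
  have "pvec_resolution I r d g"
    unfolding pvec_resolution_def
  proof (intro conjI allI impI ballI im0)
    show "g 0 j \<in> free_comp 1 (\<lambda>_. 0) (d 0 j)" if "j < r 0" for j
    proof -
      have "\<epsilon> (unit_vec j) \<in> poly_comp (d 0 j)"
        using res(1) unit_vec_free_comp[OF that, of "d 0"]
        unfolding graded_hom_def free_module_simps ideal_module_simps by blast
      then show ?thesis by (simp add: g_def emb_free_comp del: One_nat_def)
    qed
    show "g (Suc i) j \<in> free_comp (r i) (d i) (d (Suc i) j)" if "j < r (Suc i)" for i j
    proof -
      have "\<delta> i ` free_comp (r (Suc i)) (d (Suc i)) (d (Suc i) j) \<subseteq> free_comp (r i) (d i) (d (Suc i) j)"
        using res(3)[of i] unfolding graded_hom_def free_module_simps by (elim conjE allE)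
      then show ?thesis
        using unit_vec_free_comp[OF that, of "d (Suc i)"] by (auto simp: g_def)
    qed
    show "lincomb (r (Suc i)) (g (Suc i)) ` free_carr (r (Suc i)) = {v \<in> free_carr (r i). lincomb (r i) (g i) v = 0}" for i
      unfolding ker by (rule image_cong[OF refl gS])
    show "lookup (v j) 0 = 0" if "v \<in> free_carr (r i)" "lincomb (r i) (g i) v = 0" for i v j
    proof -
      have "v \<in> \<delta> i ` free_carr (r (Suc i))" unfolding ker[symmetric] using that by simp
      then obtain u where "u \<in> free_carr (r (Suc i))" "v = \<delta> i u" by (rule imageE)
      then have "v j \<in> irrelevant_ideal" using min by simp
      then show ?thesis by (simp add: in_irrelevant_ideal_iff)
    qed
  qed
  then show thesis by (rule that)
qed

definition ideal_family :: "('n::finite, 'k::field) mpoly set \<Rightarrow> int \<Rightarrow> ('n, 'k) pvec set" where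
  "ideal_family I e = emb ` (I \<inter> poly_comp e)"

lemma graded_family_ideal:
  assumes "is_ideal I"
  shows "graded_family (ideal_family I)"
  unfolding graded_family_def
proof (intro conjI allI ballI)
  show "0 \<in> ideal_family I e" for e
    using idl.subspace_0[OF assms] by (auto simp: ideal_family_def intro!: image_eqI[of _ _ 0])
  show "u + v \<in> ideal_family I e" if "u \<in> ideal_family I e" "v \<in> ideal_family I e" for e u v
    using that by (auto simp: ideal_family_def emb_add[symmetric] intro: idl.subspace_add[OF assms] poly_comp_add)
  show "vscale p v \<in> ideal_family I (a + e)" if "p \<in> poly_comp a" "v \<in> ideal_family I e" for a e p v
    using that by (auto simp: ideal_family_def emb_scale[symmetric] intro: idl.subspace_scale[OF assms] poly_comp_mult)
qed

text \<open>
  The graded module that is resolved from step \<open>i\<close> on: \<open>I\<close> itself, and then the syzygy modules.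
\<close>

definition res_family :: "('n::finite, 'k::field) mpoly set \<Rightarrow> (nat \<Rightarrow> nat) \<Rightarrow>
    (nat \<Rightarrow> nat \<Rightarrow> int) \<Rightarrow> (nat \<Rightarrow> nat \<Rightarrow> ('n, 'k) pvec) \<Rightarrow> nat \<Rightarrow> int \<Rightarrow> ('n, 'k) pvec set" where
  "res_family I r d g i = (case i of 0 \<Rightarrow> ideal_family I | Suc k \<Rightarrow> syz_comp (r k) (g k) (d k))"

text \<open>
  Exactness is stated for all elements, whereas \<^const>\<open>generated_by\<close> concerns homogeneous ones: the
  homogeneous component of a preimage is again a preimage.
\<close>

lemma generated_by_res_family:
  assumes res: "pvec_resolution I r d g"
  shows "generated_by (res_family I r d g i) (r i) (g i) (d i)"
proof -
  \<comment> \<open>The shifts of the module in which the generators \<open>g i\<close> live.\<close>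
  obtain s D where hom: "\<And>j. j < r i \<Longrightarrow> g i j \<in> free_comp s D (d i j)"
    and fam: "\<And>e. res_family I r d g i e = lincomb (r i) (g i) ` free_carr (r i) \<inter> free_comp s D e"
  proof (cases i)
    case 0
    have "emb ` (I \<inter> poly_comp e) = emb ` I \<inter> free_comp 1 (\<lambda>_. 0) e" for e
      by (auto simp: emb_free_comp simp del: One_nat_def)
    then show ?thesis
      using that[of 1 "\<lambda>_. 0"] pvec_resolution_gens_0[OF res] pvec_resolution_image_0[OF res] 0
      by (simp add: res_family_def ideal_family_def del: One_nat_def)
  next
    case (Suc k)
    have "syz_comp (r k) (g k) (d k) e = {v \<in> free_carr (r k). lincomb (r k) (g k) v = 0} \<inter> free_comp (r k) (d k) e" for e
      by (auto simp: syz_comp_def free_comp_def)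
    then show ?thesis
      using that[of "r k" "d k"] pvec_resolution_gens_Suc[OF res] pvec_resolution_image_Suc[OF res, of k] Suc
      by (simp add: res_family_def)
  qed
  show ?thesis
    unfolding generated_by_def
  proof (intro conjI allI impI ballI)
    fix j assume j: "j < r i"
    have "unit_vec j \<in> free_carr (r i)" using j by (simp add: unit_vec_def)
    then have "g i j \<in> lincomb (r i) (g i) ` free_carr (r i)"
      using lincomb_unit_vec[OF j, of "g i"] by (intro image_eqI[of _ _ "unit_vec j"]) auto
    then show "g i j \<in> res_family I r d g i (d i j)"
      using hom[OF j] by (simp add: fam)
  next
    fix e m assume "m \<in> res_family I r d g i e"
    then obtain v where v: "v \<in> free_carr (r i)" "m = lincomb (r i) (g i) v" "m \<in> free_comp s D e"
      by (auto simp: fam)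
    have "lincomb (r i) (g i) (vec_hom_part (d i) e v) = vec_hom_part D e m"
      using vec_hom_part_lincomb[of "r i" "g i" s D "d i" e v, OF hom] v(2) by simp
    also have "\<dots> = m" by (rule vec_hom_part_id[OF v(3)])
    finally show "\<exists>v\<in>free_comp (r i) (d i) e. lincomb (r i) (g i) v = m"
      using vec_hom_part_in[OF v(1), of "d i" e] by blast
  qed
qed

lemma reg_le_if_degrees_le:
  assumes res: "pvec_resolution I r d g" and "\<And>i j. j < r i \<Longrightarrow> d i j \<le> c + int i"
  shows "reg_le n (c + int i) (res_family I r d g i)"
proof (induction n arbitrary: i)
  case (Suc n)
  have "reg_le n (c + int i + 1) (syz_comp (r i) (g i) (d i))"
    using Suc[of "Suc i"] by (simp add: res_family_def add.commute add.left_commute)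
  then show ?case
    unfolding reg_le.simps using generated_by_res_family[OF res, of i] assms(2) by blast
qed simp

text \<open>
  Along the resolution, \<open>reg_le\<close> is passed to the next syzygy module by \<open>reg_le_syz\<close>, whose hypothesis on
  the degrees of the current generators is supplied by \<open>minimal_degree_le\<close>.
\<close>

lemma degrees_le_if_reg_le:
  assumes res: "pvec_resolution I r d g" and "is_ideal I"
    and reg: "\<And>n. reg_le n c (ideal_family I)" and "j < r i"
  shows "d i j \<le> c + int i"
proof -
  have fam: "graded_family (res_family I r d g i)" for i
    by (cases i) (simp_all add: res_family_def graded_family_ideal[OF assms(2)] graded_family_syz)
  have deg: "d i j \<le> c'" if "\<And>n. reg_le n c' (res_family I r d g i)" "j < r i" for i j c'
  proof (rule minimal_degree_le[OF fam generated_by_res_family[OF res] _ that])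
    show "lookup (v k) 0 = 0" if "v \<in> syz_comp (r i) (g i) (d i) e" for v e k
      using that pvec_resolution_minimal[OF res] by (auto simp: syz_comp_def free_comp_def)
  qed
  have "reg_le n (c + int i) (res_family I r d g i)" for n
  proof (induction i arbitrary: n)
    case 0
    then show ?case using reg by (simp add: res_family_def)
  next
    case (Suc i)
    have "reg_le n (c + int i + 1) (syz_comp (r i) (g i) (d i))"
      by (rule reg_le_syz[OF fam generated_by_res_family[OF res] _ Suc]) (use deg[OF Suc] in blast)
    then show ?case by (simp add: res_family_def add.commute add.left_commute)
  qed
  then show ?thesis using deg \<open>j < r i\<close> by blast
qed


section \<open>The product of two ideals\<close>

text \<open>
  The graded pieces of \<open>JF\<close> for \<open>F = \<Oplus>\<^sub>j\<^sub><\<^sub>r S(-d\<^sub>j)\<close>, a direct sum of the modules \<open>J(-d\<^sub>j)\<close>.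
\<close>

definition ideal_multiples :: "('n::finite, 'k::field) mpoly set \<Rightarrow> nat \<Rightarrow> (nat \<Rightarrow> int) \<Rightarrow> int
    \<Rightarrow> ('n, 'k) pvec set" where
  "ideal_multiples J r d e = {v \<in> free_comp r d e. \<forall>j. v j \<in> J}"

lemma graded_family_ideal_multiples:
  assumes "is_ideal J"
  shows "graded_family (ideal_multiples J r d)"
  using graded_family_free[of r d] idl.subspace_0[OF assms] idl.subspace_add[OF assms] idl.subspace_scale[OF assms]
  unfolding graded_family_def ideal_multiples_def by (auto simp: pvec_at)

text \<open>
  Splitting off the last summand \<open>J(-d\<^sub>r)\<close> of the direct sum is an extension.
\<close>

lemma reg_le_ideal_multiples:
  assumes J: "is_ideal J" and reg: "reg_le n c (ideal_family J)" and "\<forall>j<r. d j \<le> b"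
  shows "reg_le n (b + c) (ideal_multiples J r d)"
  using assms(3)
proof (induction r)
  case 0
  have "ideal_multiples J 0 d = (\<lambda>e. {0})"
    using idl.subspace_0[OF J] by (auto simp: ideal_multiples_def free_comp_def fun_eq_iff pvec_at)
  then show ?case by (simp add: reg_le_zero)
next
  case (Suc r)
  let ?f = "\<lambda>v. emb (v r)"
  have f: "pvec_linear ?f"
    by (simp add: pvec_linear_def pvec_at emb_add emb_scale)
  show ?case
  proof (rule reg_le_extension[OF graded_family_ideal_multiples[OF J] f])
    have "{v \<in> ideal_multiples J (Suc r) d e. emb (v r) = 0} = ideal_multiples J r d e" for e
    proof (intro equalityI subsetI)
      fix v assume v: "v \<in> {v \<in> ideal_multiples J (Suc r) d e. emb (v r) = 0}"
      then have "v r = 0" using emb_inject[of "v r" 0] by simp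
      then have "v j = 0" if "r \<le> j" for j
        using v that by (cases "j = r") (auto simp: ideal_multiples_def free_comp_def)
      then show "v \<in> ideal_multiples J r d e"
        using v by (auto simp: ideal_multiples_def free_comp_def)
    next
      fix v assume v: "v \<in> ideal_multiples J r d e"
      then have "v r = 0" by (simp add: ideal_multiples_def free_comp_def)
      then show "v \<in> {v \<in> ideal_multiples J (Suc r) d e. emb (v r) = 0}"
        using v by (auto simp: ideal_multiples_def free_comp_def less_Suc_eq)
    qed
    then show "reg_le n (b + c) (\<lambda>e. {v \<in> ideal_multiples J (Suc r) d e. emb (v r) = 0})"
      using Suc by simp
    have "?f ` ideal_multiples J (Suc r) d e = ideal_family J (e - d r)" for e
    proof (intro equalityI subsetI)
      fix w assume "w \<in> ideal_family J (e - d r)"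
      then obtain p where p: "w = emb p" "p \<in> J" "p \<in> poly_comp (e - d r)" by (auto simp: ideal_family_def)
      let ?v = "\<lambda>j. if j = r then p else 0"
      have "?v \<in> ideal_multiples J (Suc r) d e"
        using p idl.subspace_0[OF J] by (auto simp: ideal_multiples_def free_comp_def)
      then show "w \<in> ?f ` ideal_multiples J (Suc r) d e"
        using p(1) by (intro image_eqI[of _ _ ?v]) auto
    next
      fix w assume "w \<in> ?f ` ideal_multiples J (Suc r) d e"
      then show "w \<in> ideal_family J (e - d r)"
        by (auto simp: ideal_family_def ideal_multiples_def free_comp_coord)
    qed
    moreover have "reg_le n (b + c) (\<lambda>e. ideal_family J (e - d r))"
      by (rule reg_le_mono[OF reg_le_shift[OF reg]]) (use Suc.prems in simp)
    ultimately show "reg_le n (b + c) (\<lambda>e. ?f ` ideal_multiples J (Suc r) d e)" by simp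
  qed
qed

text \<open>
  The modules between the steps of the complex \<open>\<dots> \<rightarrow> JF\<^sub>1 \<rightarrow> JF\<^sub>0 \<rightarrow> IJ \<rightarrow> 0\<close>: its end \<open>IJ\<close>, and then the
  kernels in \<open>JF\<^sub>0, JF\<^sub>1, \<dots>\<close>.
\<close>

definition prod_family :: "('n::finite, 'k::field) mpoly set \<Rightarrow> ('n, 'k) mpoly set \<Rightarrow> (nat \<Rightarrow> nat) \<Rightarrow>
    (nat \<Rightarrow> nat \<Rightarrow> int) \<Rightarrow> (nat \<Rightarrow> nat \<Rightarrow> ('n, 'k) pvec) \<Rightarrow> nat \<Rightarrow> int \<Rightarrow> ('n, 'k) pvec set" where
  "prod_family I J r d g i = (case i of 0 \<Rightarrow> ideal_family (ideal_prod I J)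
     | Suc k \<Rightarrow> \<lambda>e. {v \<in> ideal_multiples J (r k) (d k) e. lincomb (r k) (g k) v = 0})"

lemma lincomb_in_ideal: "is_ideal J \<Longrightarrow> (\<And>j. v j \<in> J) \<Longrightarrow> lincomb r g v i \<in> J"
  unfolding lincomb_at
  by (intro idl.subspace_sum) (auto simp: mult.commute[of "v _"] intro: idl.subspace_scale)

lemma lincomb_ideal_multiples_lift:
  assumes B: "\<forall>b\<in>B. homogeneous b" and v: "v \<in> free_carr r" "\<And>j. v j \<in> ideal_gen B"
    and hom: "\<And>j. j < r \<Longrightarrow> g j \<in> free_comp s D (d j)" and "lincomb r g v \<in> free_comp s D e"
  shows "lincomb r g v \<in> lincomb r g ` ideal_multiples (ideal_gen B) r d e"
proof (rule image_eqI)
  have "lincomb r g (vec_hom_part d e v) = vec_hom_part D e (lincomb r g v)"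
    using vec_hom_part_lincomb[of r g s D d e v, OF hom] by simp
  then show "lincomb r g v = lincomb r g (vec_hom_part d e v)"
    by (simp add: vec_hom_part_id[OF assms(5)])
  have "vec_hom_part d e v j \<in> ideal_gen B" for j
    unfolding vec_hom_part_def by (rule hom_part_in_ideal[OF B v(2)])
  then show "vec_hom_part d e v \<in> ideal_multiples (ideal_gen B) r d e"
    using vec_hom_part_in[OF v(1)] by (simp add: ideal_multiples_def)
qed

text \<open>
  Exactness of the complex. In step \<open>0\<close> the image is \<open>IJ\<close> by the definition of the product. In a later
  step, \<open>syzygies_over_ideal\<close> writes an element of the kernel as \<open>\<Sum> n w\<^sub>n\<close> with \<open>n \<in> J\<close> and syzygies \<open>w\<^sub>n\<close>;
  these lift along the resolution of \<open>I\<close>, and multiplication by the \<open>n\<close> moves the lifts into \<open>JF\<close>.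
\<close>

lemma prod_family_image:
  fixes B :: "('n::finite, 'k::field) mpoly set"
  assumes B: "\<forall>b\<in>B. homogeneous b" "B \<subseteq> polys_in (insert z (- V))" and z: "z \<in> V"
    and res: "pvec_resolution I r d g" and gV: "\<And>i j k. j < r i \<Longrightarrow> g i j k \<in> polys_in V"
  shows "lincomb (r i) (g i) ` ideal_multiples (ideal_gen B) (r i) (d i) e
     = prod_family I (ideal_gen B) r d g i e"
proof (cases i)
  case 0
  let ?J = "ideal_gen B" and ?P = "ideal_prod I (ideal_gen B)"
  have "lincomb (r 0) (g 0) ` ideal_multiples ?J (r 0) (d 0) e = emb ` (?P \<inter> poly_comp e)"
  proof (intro equalityI subsetI)
    fix w assume "w \<in> lincomb (r 0) (g 0) ` ideal_multiples ?J (r 0) (d 0) e"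
    then obtain v where v: "v \<in> free_comp (r 0) (d 0) e" "\<And>j. v j \<in> ?J" "w = lincomb (r 0) (g 0) v"
      by (auto simp: ideal_multiples_def)
    have w: "w \<in> free_comp 1 (\<lambda>_. 0) e"
      unfolding v(3) by (rule lincomb_free_comp[OF pvec_resolution_gens_0[OF res] v(1)])
    have "w 0 = (\<Sum>j<r 0. v j * g 0 j 0)" by (simp add: v(3) lincomb_at)
    also have "\<dots> \<in> ?P"
      unfolding ideal_prod_def
    proof (intro idl.span_sum idl.span_base)
      fix j assume "j \<in> {..<r 0}"
      then have j: "j < r 0" by simp
      have "unit_vec j \<in> free_carr (r 0)" using j by (simp add: unit_vec_def)
      then have "lincomb (r 0) (g 0) (unit_vec j) \<in> emb ` I"
        using pvec_resolution_image_0[OF res] by blast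
      then have "g 0 j 0 \<in> I" using lincomb_unit_vec[OF j, of "g 0"] by auto
      then show "v j * g 0 j 0 \<in> {a * b | a b. a \<in> I \<and> b \<in> ?J}"
        using v(2) mult.commute by blast
    qed
    finally have "w 0 \<in> ?P" .
    moreover have "w 0 \<in> poly_comp e" using free_comp_coord[OF w, of 0] by simp
    moreover have "w = emb (w 0)" using w by (intro free_carr_1) (simp add: free_comp_def)
    ultimately show "w \<in> emb ` (?P \<inter> poly_comp e)" by blast
  next
    fix w assume "w \<in> emb ` (?P \<inter> poly_comp e)"
    then obtain p where p: "w = emb p" "p \<in> ?P" "p \<in> poly_comp e" by blast
    have "\<exists>v. v \<in> free_carr (r 0) \<and> (\<forall>j. v j \<in> ?J) \<and> emb p = lincomb (r 0) (g 0) v"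
      using p(2) unfolding ideal_prod_def
    proof (induction rule: idl.span_induct_alt)
      case base
      show ?case
      proof (intro exI conjI allI)
        show "0 \<in> free_carr (r 0)" by (rule vec.subspace_0[OF free_carr_subspace])
        show "0 j \<in> ?J" for j :: nat by (simp only: zero_fun_apply idl.span_zero)
        show "emb 0 = lincomb (r 0) (g 0) 0"
          by (simp only: emb_0 pvec_linear_0[OF pvec_linear_lincomb_map])
      qed
    next
      case (step c x y)
      obtain v where v: "v \<in> free_carr (r 0)" "\<And>j. v j \<in> ?J" "emb y = lincomb (r 0) (g 0) v"
        using step(2) by blast
      obtain a b where ab: "x = a * b" "a \<in> I" "b \<in> ?J" using step(1) by blast
      obtain u where u: "u \<in> free_carr (r 0)" "emb a = lincomb (r 0) (g 0) u"
        using pvec_resolution_image_0[OF res] ab(2) by blast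
      have "emb (c * x) = vscale (c * b) (emb a)"
        unfolding ab(1) emb_scale[symmetric] by (simp only: mult.assoc mult.commute[of a b])
      then have "emb (c * x + y) = lincomb (r 0) (g 0) (vscale (c * b) u + v)"
        by (simp add: emb_add pvec_linear_add[OF pvec_linear_lincomb_map]
            pvec_linear_scale[OF pvec_linear_lincomb_map] u(2) v(3))
      moreover have "vscale (c * b) u + v \<in> free_carr (r 0)" using u v by (simp add: pvec_at)
      moreover have "(vscale (c * b) u + v) j \<in> ?J" for j
      proof -
        have "(c * u j) * b \<in> ?J" using ab(3) by (rule idl.span_scale)
        moreover have "(c * u j) * b = (c * b) * u j" by (simp only: mult.assoc mult.commute[of b])
        ultimately show ?thesis using v(2) by (simp add: pvec_at idl.span_add)
      qed
      ultimately show ?case by blast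
    qed
    then obtain v where v: "v \<in> free_carr (r 0)" "\<And>j. v j \<in> ?J" "emb p = lincomb (r 0) (g 0) v"
      by blast
    have L: "lincomb (r 0) (g 0) v \<in> free_comp 1 (\<lambda>_. 0) e"
      using p(3) by (simp add: emb_free_comp flip: v(3) del: One_nat_def)
    show "w \<in> lincomb (r 0) (g 0) ` ideal_multiples ?J (r 0) (d 0) e"
      unfolding p(1) v(3)
      by (rule lincomb_ideal_multiples_lift[OF B(1) v(1,2) pvec_resolution_gens_0[OF res] L])
  qed
  then show ?thesis using 0 by (simp add: prod_family_def ideal_family_def)
next
  case (Suc k)
  let ?J = "ideal_gen B"
  let ?\<Phi> = "lincomb (r (Suc k)) (g (Suc k))"
  have "?\<Phi> ` ideal_multiples ?J (r (Suc k)) (d (Suc k)) e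
      = {v \<in> ideal_multiples ?J (r k) (d k) e. lincomb (r k) (g k) v = 0}"
  proof (intro equalityI subsetI)
    fix w assume "w \<in> ?\<Phi> ` ideal_multiples ?J (r (Suc k)) (d (Suc k)) e"
    then obtain v where v: "v \<in> free_comp (r (Suc k)) (d (Suc k)) e" "\<And>j. v j \<in> ?J" "w = ?\<Phi> v"
      by (auto simp: ideal_multiples_def)
    have "w \<in> free_comp (r k) (d k) e"
      unfolding v(3) by (rule lincomb_free_comp[OF pvec_resolution_gens_Suc[OF res] v(1)])
    moreover have "w j \<in> ?J" for j
      unfolding v(3) by (rule lincomb_in_ideal[OF idl.subspace_span v(2)])
    moreover have "v \<in> free_carr (r (Suc k))" using v(1) by (simp add: free_comp_def)
    then have "lincomb (r k) (g k) w = 0"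
      using pvec_resolution_image_Suc[OF res, of k] v(3) by blast
    ultimately show "w \<in> {v \<in> ideal_multiples ?J (r k) (d k) e. lincomb (r k) (g k) v = 0}"
      by (simp add: ideal_multiples_def)
  next
    fix m assume "m \<in> {v \<in> ideal_multiples ?J (r k) (d k) e. lincomb (r k) (g k) v = 0}"
    then have m: "m \<in> free_comp (r k) (d k) e" "\<And>j. m j \<in> ?J" "lincomb (r k) (g k) m = 0"
      by (auto simp: ideal_multiples_def)
    have mc: "m \<in> free_carr (r k)" using m(1) by (simp add: free_comp_def)
    have "\<forall>j<r k. \<forall>i. g k j i \<in> polys_in V" using gV by blast
    from syzygies_over_ideal[OF B z this mc m(2,3)]
    obtain N w where N: "finite N" "N \<subseteq> ?J" and mw: "m = (\<Sum>n\<in>N. vscale n (w n))"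
      and w: "\<forall>n\<in>N. w n \<in> free_carr (r k) \<and> (\<forall>j. w n j \<in> polys_in V) \<and> lincomb (r k) (g k) (w n) = 0"
      by (elim exE conjE)
    have "\<exists>u. u \<in> free_carr (r (Suc k)) \<and> ?\<Phi> u = w n" if "n \<in> N" for n
    proof -
      have "w n \<in> {v \<in> free_carr (r k). lincomb (r k) (g k) v = 0}" using w that by blast
      then have "w n \<in> ?\<Phi> ` free_carr (r (Suc k))" by (simp only: pvec_resolution_image_Suc[OF res, of k])
      then obtain x where "w n = ?\<Phi> x" "x \<in> free_carr (r (Suc k))" by (rule imageE)
      then show ?thesis by (intro exI[of _ x]) simp
    qed
    then have "\<exists>u. \<forall>n\<in>N. u n \<in> free_carr (r (Suc k)) \<and> ?\<Phi> (u n) = w n"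
      by (intro bchoice ballI)
    then obtain u where u': "\<forall>n\<in>N. u n \<in> free_carr (r (Suc k)) \<and> ?\<Phi> (u n) = w n" ..
    have u: "u n \<in> free_carr (r (Suc k))" "?\<Phi> (u n) = w n" if "n \<in> N" for n
      using u' that by simp_all
    define v where "v = (\<Sum>n\<in>N. vscale n (u n))"
    have "v \<in> free_carr (r (Suc k))"
      unfolding v_def
      by (intro vec.subspace_sum[OF free_carr_subspace] vec.subspace_scale[OF free_carr_subspace] u)
    moreover have "v j \<in> ?J" for j
      unfolding v_def sum_fun_at vscale_apply
    proof (intro idl.span_sum)
      fix n assume "n \<in> N"
      then have "u n j * n \<in> ?J" using N(2) by (intro idl.span_scale) blast
      then show "n * u n j \<in> ?J" by (simp only: mult.commute)
    qed
    moreover have "?\<Phi> v = m"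
      using u(2) by (simp add: v_def mw pvec_linear_sum[OF pvec_linear_lincomb_map]
          pvec_linear_scale[OF pvec_linear_lincomb_map])
    ultimately have "?\<Phi> v \<in> ?\<Phi> ` ideal_multiples ?J (r (Suc k)) (d (Suc k)) e"
      using m(1) by (intro lincomb_ideal_multiples_lift[OF B(1) _ _ pvec_resolution_gens_Suc[OF res]]) simp_all
    then show "m \<in> ?\<Phi> ` ideal_multiples ?J (r (Suc k)) (d (Suc k)) e"
      by (simp only: \<open>?\<Phi> v = m\<close>)
  qed
  then show ?thesis using Suc by (simp add: prod_family_def)
qed

text \<open>
  Each short exact sequence \<open>0 \<rightarrow> ker \<rightarrow> JF\<^sub>i \<rightarrow> im \<rightarrow> 0\<close> reduces the claim for \<open>n + 1\<close> steps of the image to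
  \<open>n\<close> steps of the kernel, which is the image in step \<open>i + 1\<close> and may have degrees one higher.
\<close>

lemma reg_le_ideal_prod:
  fixes B :: "('n::finite, 'k::field) mpoly set"
  assumes B: "\<forall>b\<in>B. homogeneous b" "B \<subseteq> polys_in (insert z (- V))" and z: "z \<in> V"
    and res: "pvec_resolution I r d g" and gV: "\<And>i j k. j < r i \<Longrightarrow> g i j k \<in> polys_in V"
    and I: "\<And>i j. j < r i \<Longrightarrow> d i j \<le> b + int i"
    and J: "\<And>n. reg_le n c (ideal_family (ideal_gen B))"
  shows "reg_le n (b + c + int i) (prod_family I (ideal_gen B) r d g i)"
proof (induction n arbitrary: i)
  case (Suc n)
  let ?F = "ideal_multiples (ideal_gen B) (r i) (d i)" and ?f = "lincomb (r i) (g i)"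
  have "reg_le (Suc n) (b + int i + c) ?F"
    by (rule reg_le_ideal_multiples[OF idl.subspace_span J]) (use I in simp)
  then have 1: "reg_le (Suc n) (b + c + int i) ?F" by (simp only: add.commute add.left_commute)
  have 2: "reg_le n (b + c + int i + 1) (\<lambda>e. {v \<in> ?F e. ?f v = 0})"
    using Suc[of "Suc i"] by (simp add: prod_family_def add.commute add.left_commute)
  have "reg_le (Suc n) (b + c + int i) (\<lambda>e. ?f ` ?F e)"
    by (rule reg_le_quotient[OF graded_family_ideal_multiples[OF idl.subspace_span] pvec_linear_lincomb_map 1 2])
  then show ?case by (simp only: prod_family_image[OF B z res gV])
qed simp


section \<open>Regularity of the product\<close>

lemma shift_le_reg:
  assumes "e \<in> shifts M i"
  shows "ereal (real_of_int e - real i) \<le> reg M"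
proof -
  have "ereal (real_of_int e) \<le> max_shift M i"
    unfolding max_shift_def by (rule SUP_upper[OF assms])
  then have "ereal (real_of_int e) - ereal (real i) \<le> max_shift M i - ereal (real i)"
    by (rule ereal_minus_mono) simp
  also have "\<dots> \<le> reg M" unfolding reg_def by (rule SUP_upper) simp
  finally show ?thesis by simp
qed

lemma reg_leI:
  assumes "\<And>i e. e \<in> shifts M i \<Longrightarrow> real_of_int e \<le> c + real i"
  shows "reg M \<le> ereal c"
  unfolding reg_def
proof (rule SUP_least)
  fix i
  have "max_shift M i \<le> ereal (c + real i)"
    unfolding max_shift_def by (rule SUP_least) (use assms in simp)
  then have "max_shift M i - ereal (real i) \<le> ereal (c + real i) - ereal (real i)"
    by (rule ereal_minus_mono) simp
  then show "max_shift M i - ereal (real i) \<le> ereal c" by simp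
qed

lemma resolution_degree_le:
  assumes "pvec_resolution I r d g" "reg (ideal_module I) \<le> ereal x" "j < r i"
  shows "d i j \<le> \<lfloor>x\<rfloor> + int i"
proof -
  have "d i j \<in> shifts (ideal_module I) i"
    unfolding shifts_def using pvec_resolution_imp_minimal_resolution[OF assms(1)] assms(3) by blast
  from order_trans[OF shift_le_reg[OF this] assms(2)]
  have "real_of_int (d i j - int i) \<le> x" by simp
  then show ?thesis by linarith
qed

text \<open>
  The bounds on the regularities enter through the minimal resolutions of the two ideals, and the
  conclusion concerns an arbitrary minimal resolution of the product. Shifts are integers, hence
  the real bounds may be rounded down.
\<close>

lemma reg_ideal_prod_le:
  fixes A B :: "('n::finite, 'k::field) mpoly set"
  assumes A: "\<forall>a\<in>A. homogeneous a" "A \<subseteq> polys_in V"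
    and B: "\<forall>b\<in>B. homogeneous b" "B \<subseteq> polys_in (insert z (- V))" and z: "z \<in> V"
    and x: "reg (ideal_module (ideal_gen A)) \<le> ereal x" and y: "reg (ideal_module (ideal_gen B)) \<le> ereal y"
  shows "reg (ideal_module (ideal_prod (ideal_gen A) (ideal_gen B))) \<le> ereal (x + y)"
proof -
  let ?I = "ideal_gen A" and ?J = "ideal_gen B"
  let ?P = "ideal_prod ?I ?J"
  have "V \<noteq> {}" using z by blast
  obtain r d g where res: "pvec_resolution ?I r d g" and gV: "\<And>i j k. j < r i \<Longrightarrow> g i j k \<in> polys_in V"
    using pvec_resolution_exists[OF A \<open>V \<noteq> {}\<close>] by blast
  obtain r' d' g' where res': "pvec_resolution ?J r' d' g'"
    using pvec_resolution_exists[OF B(1), of UNIV] by auto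
  have "reg_le n (\<lfloor>y\<rfloor> + int 0) (res_family ?J r' d' g' 0)" for n
    by (rule reg_le_if_degrees_le[OF res' resolution_degree_le[OF res' y]])
  then have J: "reg_le n \<lfloor>y\<rfloor> (ideal_family ?J)" for n by (simp add: res_family_def)
  have "reg_le n (\<lfloor>x\<rfloor> + \<lfloor>y\<rfloor> + int 0) (prod_family ?I ?J r d g 0)" for n
    by (rule reg_le_ideal_prod[OF B z res gV resolution_degree_le[OF res x] J])
  then have P: "reg_le n (\<lfloor>x\<rfloor> + \<lfloor>y\<rfloor>) (ideal_family ?P)" for n by (simp add: prod_family_def)
  show ?thesis
  proof (rule reg_leI)
    fix i e assume "e \<in> shifts (ideal_module ?P) i"
    then obtain r d \<delta> \<epsilon> j where "minimal_graded_free_resolution (ideal_module ?P) r d \<delta> \<epsilon>"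
      and j: "j < r i" "e = d i j" by (auto simp: shifts_def)
    then obtain g where g: "pvec_resolution ?P r d g"
      using minimal_resolution_imp_pvec_resolution by blast
    have "is_ideal ?P" by (simp add: ideal_prod_def)
    from degrees_le_if_reg_le[where r = r and d = d and i = i and j = j, OF g this P j(1)]
    have "e \<le> \<lfloor>x\<rfloor> + \<lfloor>y\<rfloor> + int i" by (simp only: j(2))
    then show "real_of_int e \<le> x + y + real i" by linarith
  qed
qed

theorem theorem1p6:
  fixes I J A B :: "('n::finite, 'k::field) mpoly set"
  assumes "homogeneous_ideal I" and "homogeneous_ideal J"
    and "minimal_homogeneous_gens A I" and "minimal_homogeneous_gens B J"
    and "card (Gens B \<inter> Gens A) \<le> 1"
  shows "reg (ideal_module (ideal_prod I J)) \<le> reg (ideal_module I) + reg (ideal_module J)"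
proof -
  have A: "\<forall>a\<in>A. homogeneous a" "ideal_gen A = I" and B: "\<forall>b\<in>B. homogeneous b" "ideal_gen B = J"
    using assms(3,4) by (auto simp: minimal_homogeneous_gens_def)
  have "\<forall>a\<in>Gens B \<inter> Gens A. \<forall>b\<in>Gens B \<inter> Gens A. a = b"
    using assms(5) card_le_Suc0_iff_eq[of "Gens B \<inter> Gens A"] by simp
  then obtain z where z: "Gens B \<inter> Gens A \<subseteq> {z}" by blast
  define V where "V = insert z (Gens A)"
  have "A \<subseteq> polys_in V" by (auto simp: V_def Gens_def polys_in_def)
  moreover have "B \<subseteq> polys_in (insert z (- V))" using z by (auto simp: V_def Gens_def polys_in_def)
  ultimately have le: "reg (ideal_module (ideal_prod I J)) \<le> ereal (x + y)"
    if "reg (ideal_module I) \<le> ereal x" "reg (ideal_module J) \<le> ereal y" for x y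
    using reg_ideal_prod_le[of A V B z x y] A B that by (simp add: V_def)
  \<comment> \<open>If one regularity is \<open>- \<infinity>\<close>, it is below every real number, which forces the product
    to have regularity \<open>- \<infinity>\<close> as well, unless the other one is \<open>\<infinity>\<close>.\<close>
  show ?thesis
  proof (cases "reg (ideal_module I)"; cases "reg (ideal_module J)")
    fix a assume a: "reg (ideal_module I) = ereal a" and "reg (ideal_module J) = - \<infinity>"
    then have "reg (ideal_module (ideal_prod I J)) \<le> ereal b" for b using le[of a "b - a"] by simp
    then show ?thesis using ereal_bot by fastforce
  next
    fix b assume b: "reg (ideal_module J) = ereal b" and "reg (ideal_module I) = - \<infinity>"
    then have "reg (ideal_module (ideal_prod I J)) \<le> ereal a" for a using le[of "a - b" b] by simp
    then show ?thesis using ereal_bot by fastforce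
  next
    assume "reg (ideal_module I) = - \<infinity>" "reg (ideal_module J) = - \<infinity>"
    then have "reg (ideal_module (ideal_prod I J)) \<le> ereal a" for a using le[of a 0] by simp
    then show ?thesis using ereal_bot by fastforce
  qed (use le in auto)
qed

end
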